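(* Let $\mathcal T$ be a simplicial complex with a (possibly empty) subcomplex $\mathcal U$, and let $\mathcal P=(\mathcal P_T)_{T\in\mathcal T}$ be a family of admissible sequence types satisfying the hierarchy condition, with local extension operators and associated global extension operators $\operatorname{Ext}^k_F$, as described in the context. Then $$\mathcal P\Lambda^k(\mathcal T,\mathcal U)=\mathcal W\Lambda^k(\mathcal T,\mathcal U)\oplus\bigoplus_{F\in\mathcal T\setminus\mathcal U}\operatorname{Ext}^k_F\,\underline{\mathring{\mathcal P}}\Lambda^k(F).$$
   Context: **Simplices and polynomial forms.** Simplices are closed nondegenerate simplices in some $\mathbb R^N$, each with a fixed orientation. For a simplex $T$ of dimension $n_T$, $\Delta(T)$ is the set of its subsimplices (including $T$). $C^\infty\Lambda^k(T)$ is the space of smooth differential $k$-forms on $T$ (pullbacks of smooth forms on the ambient space; zero for $k\notin\{0,\dots,n_T\}$), and for $F\in\Delta(T)$, $\operatorname{tr}^k_{T,F}$ is pullback of $k$-forms along the inclusion $F\to T$. With barycentric coordinates $\lambda_0,\dots,\lambda_{n_T}$ of $T$ and $r\in\mathbb Z$: $\mathcal P_r\Lambda^k(T)$ is spanned by $\lambda^\alpha d\lambda_{\sigma(1)}\wedge\dots\wedge d\lambda_{\sigma(k)}$ with $\alpha\in\mathbb N_0^{n_T+1}$, $|\alpha|=r$, $0\le\sigma(1)<\dots<\sigma(k)\le n_T$; $\mathcal P^-_r\Lambda^k(T)$ is spanned by $\lambda^\alpha\phi_\rho$ with $|\alpha|=r-1$, $0\le\rho(0)<\dots<\rho(k)\le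 n_T$, where $\phi_\rho=\sum_{i=0}^k(-1)^i\lambda_{\rho(i)}\,d\lambda_{\rho(0)}\wedge\dots\widehat{d\lambda_{\rho(i)}}\dots\wedge d\lambda_{\rho(k)}$. (So $\mathcal P_r\Lambda^k=0$ for $r<0$ and $\mathcal P_r^-\Lambda^k=0$ for $r\le0$.) **Types.** $\mathscr S=\{\dots,\mathcal P_{r-1},\mathcal P_r^-,\mathcal P_r,\mathcal P_{r+1}^-,\dots\}$ ($r\in\mathbb Z$) is a set of formal symbols, totally ordered by $\mathcal P_r^-\le\mathcal P_r\le\mathcal P_{r+1}^-$. An admissible sequence type is a map $\mathcal P:\mathbb Z\to\mathscr S$ such that $\mathcal P(k)\in\{\mathcal P_r^-,\mathcal P_r\}$ implies $\mathcal P(k+1)\in\{\mathcal P_r^-,\mathcal P_{r-1}\}$; $\mathcal P\le\mathcal S$ means $\mathcal P(k)\le\mathcal S(k)$ for all $k$. $\mathcal P\Lambda^k(T)$ is $\mathcal P_r\Lambda^k(T)$ or $\mathcal P_r^-\Lambda^k(T)$ according to $\mathcal P(k)=\mathcal P_r$ or $\mathcal P_r^-$. $\mathring{\mathcal P}\Lambda^k(T)$ is the subspace of forms whose traces on all proper subsimplices of $T$ vanish; $\underline{\mathring{\mathcal P}}\Lambda^k(T)=\mathring{\mathcal P}\Lambda^k(T)$ if $k\ne\dim T$, and $=\mathring{\mathcal P}\Lambda^k(T)\cap\ker\int_T$ if $k=\dim T$. **Triangulation.** A simplicial complex $\mathcal T$ is a set of simplices closed under taking subsimplices such that two members intersect in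 the empty set or in a member of $\mathcal T$. $C^\infty\Lambda^k(\mathcal T)$ is the space of families $\omega=(\omega_T)_T\in\bigoplus_{T\in\mathcal T}C^\infty\Lambda^k(T)$ with $\operatorname{tr}^k_{T,F}\omega_T=\omega_F$ for all $T\in\mathcal T$, $F\in\Delta(T)$. $C^\infty\Lambda^k(\mathcal T,\mathcal U)$ is the subspace with $\omega_F=0$ for all $F\in\mathcal U$. To each $T\in\mathcal T$ an admissible sequence type $\mathcal P_T$ is assigned; write $\mathcal P\Lambda^k(T):=\mathcal P_T\Lambda^k(T)$ and similarly for the other spaces. Hierarchy condition: $\mathcal P_F\le\mathcal P_T$ whenever $F\in\Delta(T)$. $\mathcal P\Lambda^k(\mathcal T)=\{\omega\in C^\infty\Lambda^k(\mathcal T):\omega_T\in\mathcal P\Lambda^k(T)\ \forall T\in\mathcal T\}$, $\mathcal P\Lambda^k(\mathcal T,\mathcal U)=\mathcal P\Lambda^k(\mathcal T)\cap C^\infty\Lambda^k(\mathcal T,\mathcal U)$. Whitney forms: $\mathcal W\Lambda^k(\mathcal T,\mathcal U)=\{\omega\in C^\infty\Lambda^k(\mathcal T,\mathcal U):\omega_T\in\mathcal P_1^-\Lambda^k(T)\ \forall T\in\mathcal T\}$. **Extension operators.** For all $k$, $T\in\mathcal T$, $F\in\Delta(T)$, linear maps $\operatorname{ext}^k_{F,T}:\underline{\mathring{\mathcal P}}\Lambda^k(F)\to\mathcal P\Lambda^k(T)$ are given with: $\operatorname{ext}^k_{F,F}=\mathrm{id}$; $\operatorname{tr}^k_{T,F}\operatorname{ext}^k_{f,T}=\operatorname{ext}^k_{f,F}$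 for $F\in\Delta(T)$, $f\in\Delta(F)$; $\operatorname{tr}^k_{T,G}\operatorname{ext}^k_{F,T}=0$ for $F,G\in\Delta(T)$, $F\notin\Delta(G)$. The global operator $\operatorname{Ext}^k_F:\underline{\mathring{\mathcal P}}\Lambda^k(F)\to\mathcal P\Lambda^k(\mathcal T)$ sends $\eta$ to the family with $T$-component $\operatorname{ext}^k_{F,T}\eta$ if $F\in\Delta(T)$ and $0$ otherwise.
   Formalization: Added: P_1^-Λ^k(T) ⊆ PΛ^k(T) for every T in the complex; without it the claim fails (one vertex, k=0, type P_0^-: PΛ^0=0 but WΛ^0 is 1-dimensional). Also explicit: each Ext^k_F η has finite support, as the direct sum requires. *)

theory Defs
  imports "HOL-Analysis.Analysis" "HOL-Library.Function_Algebras" "HOL-Combinatorics.Permutations"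
begin

section \<open>Differential forms on a simplex\<close>

text \<open>
  A form assigns to a point and a list of tangent vectors a real number.  So that equality of forms
  is equality of functions, a \<open>k\<close>-form on \<open>T\<close> is required to vanish on points outside \<open>T\<close>, on
  vectors not tangent to \<open>T\<close>, and on lists of length other than \<open>k\<close>.  The degree \<open>k\<close> is an integer;
  for negative \<open>k\<close> only the zero form remains.  Addition and zero are the pointwise ones.
\<close>

type_synonym 'a form = "'a \<Rightarrow> 'a list \<Rightarrow> real"

definition form_scale :: "real \<Rightarrow> 'a form \<Rightarrow> 'a form" where
  "form_scale c \<omega> = (\<lambda>x ws. c * \<omega> x ws)"

global_interpretation form: vector_space form_scale
  by unfold_locales (auto simp: form_scale_def fun_eq_iff algebra_simps)

definition tangent :: "'a::euclidean_space set \<Rightarrow> 'a set" where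
  "tangent T = span {x - y | x y. x \<in> T \<and> y \<in> T}"

text \<open>Pullback of a form, given on the ambient space or on a larger simplex, along the inclusion of
  \<open>T\<close>.  It does not depend on the simplex the form is defined on.\<close>

definition tr :: "'a::euclidean_space set \<Rightarrow> 'a form \<Rightarrow> 'a form" where
  "tr T \<omega> = (\<lambda>x ws. if x \<in> T \<and> set ws \<subseteq> tangent T then \<omega> x ws else 0)"

primrec C_k :: "nat \<Rightarrow> ('a::euclidean_space \<Rightarrow> real) \<Rightarrow> bool" where
  "C_k 0 f \<longleftrightarrow> continuous_on UNIV f"
| "C_k (Suc n) f \<longleftrightarrow>
     (\<exists>f'. (\<forall>x. (f has_derivative f' x) (at x)) \<and> (\<forall>v. C_k n (\<lambda>x. f' x v)))"

definition alternating_form :: "int \<Rightarrow> ('a::euclidean_space list \<Rightarrow> real) \<Rightarrow> bool" where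
  "alternating_form k \<alpha> \<longleftrightarrow>
     (\<forall>ws. int (length ws) \<noteq> k \<longrightarrow> \<alpha> ws = 0) \<and>
     (\<forall>ws. \<forall>i<length ws. linear (\<lambda>v. \<alpha> (ws[i := v]))) \<and>
     (\<forall>ws. \<forall>j<length ws. \<forall>i<j. ws ! i = ws ! j \<longrightarrow> \<alpha> ws = 0)"

definition smooth_ambient_forms :: "int \<Rightarrow> 'a::euclidean_space form set" where
  "smooth_ambient_forms k =
     {\<omega>. (\<forall>x. alternating_form k (\<omega> x)) \<and> (\<forall>ws n. C_k n (\<lambda>x. \<omega> x ws))}"

definition smooth_forms :: "int \<Rightarrow> 'a::euclidean_space set \<Rightarrow> 'a form set" where
  "smooth_forms k T = tr T ` smooth_ambient_forms k"


section \<open>Simplices, barycentric coordinates, integration\<close>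

definition nondeg_simplex :: "'a::euclidean_space set \<Rightarrow> bool" where
  "nondeg_simplex T \<longleftrightarrow> T \<noteq> {} \<and> (\<exists>n. n simplex T)"

definition subsimplices :: "'a::euclidean_space set \<Rightarrow> 'a set set" where
  "subsimplices T = {F. F face_of T \<and> F \<noteq> {}}"

text \<open>An enumeration of the vertices of \<open>T\<close>.  It numbers the barycentric coordinates of \<open>T\<close> and also
  represents the orientation of \<open>T\<close> (points are positively oriented).\<close>

definition vertex_ordering :: "'a::euclidean_space set \<Rightarrow> 'a list \<Rightarrow> bool" where
  "vertex_ordering T vs \<longleftrightarrow> distinct vs \<and> set vs = {v. v extreme_point_of T}"

definition bary :: "'a::euclidean_space list \<Rightarrow> nat \<Rightarrow> 'a \<Rightarrow> real" where
  "bary vs i x = (THE t. \<exists>c. (\<Sum>j<length vs. c j) = 1 \<and>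
     (\<Sum>j<length vs. c j *\<^sub>R vs ! j) = x \<and> c i = t)"

text \<open>The coordinate \<open>\<lambda>\<^sub>i\<close> is affine on the affine hull of the vertices, so its differential is
  constant there and equals the increment of \<open>\<lambda>\<^sub>i\<close> along a tangent vector.\<close>

definition dbary :: "'a::euclidean_space list \<Rightarrow> nat \<Rightarrow> 'a \<Rightarrow> real" where
  "dbary vs i w = bary vs i (vs ! 0 + w) - bary vs i (vs ! 0)"

text \<open>Wedge product of covectors, normalised as the determinant of the matrix of values.\<close>

definition wedge :: "('a \<Rightarrow> real) list \<Rightarrow> 'a list \<Rightarrow> real" where
  "wedge as ws = (if length ws = length as
     then \<Sum>p | p permutes {..<length as}. of_int (sign p) * (\<Prod>i<length as. (as ! i) (ws ! p i))
     else 0)"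

text \<open>For \<open>vs = [v\<^sub>0, \<dots>, v\<^sub>n]\<close>, the integral of an \<open>n\<close>-form over the simplex spanned and oriented by
  \<open>vs\<close>: its pullback under \<open>t \<mapsto> v\<^sub>0 + \<Sum> t\<^sub>i (v\<^sub>i\<^sub>+\<^sub>1 - v\<^sub>0)\<close> is integrated over the standard simplex
  of \<open>\<real>\<^sup>n\<close>.  For \<open>n = 0\<close> the product measure is a unit point mass and this is evaluation at \<open>v\<^sub>0\<close>.\<close>

definition simplex_integral :: "'a::euclidean_space list \<Rightarrow> 'a form \<Rightarrow> real" where
  "simplex_integral vs \<omega> = (let n = length vs - 1; e = (\<lambda>i. vs ! Suc i - vs ! 0) in
     LINT t : {t. (\<forall>i<n. 0 \<le> t i) \<and> (\<Sum>i<n. t i) \<le> 1} | (\<Pi>\<^sub>M i\<in>{..<n}. lborel).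
       \<omega> (vs ! 0 + (\<Sum>i<n. t i *\<^sub>R e i)) (map e [0..<n]))"


section \<open>Polynomial differential forms\<close>

definition bary_monomial :: "'a::euclidean_space list \<Rightarrow> (nat \<Rightarrow> nat) \<Rightarrow> 'a \<Rightarrow> real" where
  "bary_monomial vs \<alpha> x = (\<Prod>i<length vs. bary vs i x ^ \<alpha> i)"

definition incr_tuples :: "'a list \<Rightarrow> int \<Rightarrow> nat list set" where
  "incr_tuples vs m = {\<sigma>. sorted_wrt (<) \<sigma> \<and> set \<sigma> \<subseteq> {..<length vs} \<and> int (length \<sigma>) = m}"

definition whitney_form :: "'a::euclidean_space list \<Rightarrow> nat list \<Rightarrow> 'a form" where
  "whitney_form vs \<rho> = (\<lambda>x ws. \<Sum>i<length \<rho>. (-1) ^ i * bary vs (\<rho> ! i) x *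
     wedge (map (dbary vs) (take i \<rho> @ drop (Suc i) \<rho>)) ws)"

text \<open>The symbols \<open>PMinus r\<close> and \<open>PFull r\<close> stand for \<open>\<P>\<^sub>r\<^sup>-\<close> and \<open>\<P>\<^sub>r\<close>.\<close>

datatype ptype = PMinus int | PFull int

primrec ptype_rank :: "ptype \<Rightarrow> int" where
  "ptype_rank (PMinus r) = 2 * r"
| "ptype_rank (PFull r) = 2 * r + 1"

lemma ptype_rank_inject: "ptype_rank a = ptype_rank b \<Longrightarrow> a = b"
  by (cases a; cases b) (simp_all, presburger+)

instantiation ptype :: linorder
begin
definition "a \<le> b \<longleftrightarrow> ptype_rank a \<le> ptype_rank b"
definition "a < b \<longleftrightarrow> ptype_rank a < ptype_rank b"
instance
  by standard (auto simp: less_eq_ptype_def less_ptype_def intro: ptype_rank_inject)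
end

lemma ptype_order: "PMinus r < PFull r" "PFull r < PMinus (r + 1)"
  by (simp_all add: less_ptype_def)

text \<open>Sequence types are compared by the pointwise order on functions.\<close>

definition admissible :: "(int \<Rightarrow> ptype) \<Rightarrow> bool" where
  "admissible P \<longleftrightarrow>
     (\<forall>k r. P k \<in> {PMinus r, PFull r} \<longrightarrow> P (k + 1) \<in> {PMinus r, PFull (r - 1)})"

text \<open>In the following, \<open>vo\<close> selects a vertex ordering of each simplex.\<close>

fun poly_forms :: "('a::euclidean_space set \<Rightarrow> 'a list) \<Rightarrow> ptype \<Rightarrow> int \<Rightarrow> 'a set \<Rightarrow> 'a form set" where
  "poly_forms vo (PFull r) k T = form.span
     {tr T (\<lambda>x ws. bary_monomial (vo T) \<alpha> x * wedge (map (dbary (vo T)) \<sigma>) ws) | \<alpha> \<sigma>.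
        int (\<Sum>i<length (vo T). \<alpha> i) = r \<and> \<sigma> \<in> incr_tuples (vo T) k}"
| "poly_forms vo (PMinus r) k T = form.span
     {tr T (\<lambda>x ws. bary_monomial (vo T) \<alpha> x * whitney_form (vo T) \<rho> x ws) | \<alpha> \<rho>.
        int (\<Sum>i<length (vo T). \<alpha> i) = r - 1 \<and> \<rho> \<in> incr_tuples (vo T) (k + 1)}"

definition bubble_forms ::
    "('a::euclidean_space set \<Rightarrow> 'a list) \<Rightarrow> ptype \<Rightarrow> int \<Rightarrow> 'a set \<Rightarrow> 'a form set" where
  "bubble_forms vo p k T =
     {\<omega> \<in> poly_forms vo p k T. \<forall>F\<in>subsimplices T. F \<noteq> T \<longrightarrow> tr F \<omega> = 0}"

definition bubble0_forms ::
    "('a::euclidean_space set \<Rightarrow> 'a list) \<Rightarrow> ptype \<Rightarrow> int \<Rightarrow> 'a set \<Rightarrow> 'a form set" where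
  "bubble0_forms vo p k T =
     {\<omega> \<in> bubble_forms vo p k T. k = aff_dim T \<longrightarrow> simplex_integral (vo T) \<omega> = 0}"


section \<open>Triangulations\<close>

text \<open>Unlike \<^const>\<open>simplicial_complex\<close>, this does not demand finiteness, and the empty
  set is not a simplex.\<close>

definition simplex_complex :: "'a::euclidean_space set set \<Rightarrow> bool" where
  "simplex_complex \<T> \<longleftrightarrow>
     (\<forall>T\<in>\<T>. nondeg_simplex T \<and> subsimplices T \<subseteq> \<T>) \<and>
     (\<forall>S\<in>\<T>. \<forall>T\<in>\<T>. S \<inter> T = {} \<or> S \<inter> T \<in> \<T>)"

text \<open>Families of forms indexed by \<open>\<T>\<close> are functions on all sets that are zero off \<open>\<T>\<close>.
  Members of the direct sum over \<open>\<T>\<close> have finite support.\<close>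

type_synonym 'a form_family = "'a set \<Rightarrow> 'a form"

definition smooth_families :: "int \<Rightarrow> 'a::euclidean_space set set \<Rightarrow> 'a set set \<Rightarrow> 'a form_family set"
  where "smooth_families k \<T> \<U> =
     {\<omega>. (\<forall>T. T \<notin> \<T> \<longrightarrow> \<omega> T = 0) \<and> finite {T. \<omega> T \<noteq> 0} \<and>
         (\<forall>T\<in>\<T>. \<omega> T \<in> smooth_forms k T) \<and>
         (\<forall>T\<in>\<T>. \<forall>F\<in>subsimplices T. tr F (\<omega> T) = \<omega> F) \<and>
         (\<forall>F\<in>\<U>. \<omega> F = 0)}"

definition poly_families :: "('a::euclidean_space set \<Rightarrow> 'a list) \<Rightarrow> ('a set \<Rightarrow> int \<Rightarrow> ptype) \<Rightarrow>
    int \<Rightarrow> 'a set set \<Rightarrow> 'a set set \<Rightarrow> 'a form_family set" where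
  "poly_families vo P k \<T> \<U> =
     {\<omega> \<in> smooth_families k \<T> \<U>. \<forall>T\<in>\<T>. \<omega> T \<in> poly_forms vo (P T k) k T}"

definition whitney_families :: "('a::euclidean_space set \<Rightarrow> 'a list) \<Rightarrow>
    int \<Rightarrow> 'a set set \<Rightarrow> 'a set set \<Rightarrow> 'a form_family set" where
  "whitney_families vo k \<T> \<U> =
     {\<omega> \<in> smooth_families k \<T> \<U>. \<forall>T\<in>\<T>. \<omega> T \<in> poly_forms vo (PMinus 1) k T}"


section \<open>Extension operators\<close>

text \<open>The operator \<open>ext k F T\<close> is only constrained on the space \<^const>\<open>bubble0_forms\<close> of \<open>F\<close>.\<close>

definition extension_operators :: "('a::euclidean_space set \<Rightarrow> 'a list) \<Rightarrow>
    ('a set \<Rightarrow> int \<Rightarrow> ptype) \<Rightarrow> 'a set set \<Rightarrow>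
    (int \<Rightarrow> 'a set \<Rightarrow> 'a set \<Rightarrow> 'a form \<Rightarrow> 'a form) \<Rightarrow> bool" where
  "extension_operators vo P \<T> ext \<longleftrightarrow> (let B = (\<lambda>k F. bubble0_forms vo (P F k) k F) in
     (\<forall>k. \<forall>T\<in>\<T>. \<forall>F\<in>subsimplices T. \<forall>\<eta>\<in>B k F. ext k F T \<eta> \<in> poly_forms vo (P T k) k T) \<and>
     (\<forall>k. \<forall>T\<in>\<T>. \<forall>F\<in>subsimplices T. \<forall>\<eta>\<in>B k F. \<forall>\<theta>\<in>B k F.
        ext k F T (\<eta> + \<theta>) = ext k F T \<eta> + ext k F T \<theta>) \<and>
     (\<forall>k. \<forall>T\<in>\<T>. \<forall>F\<in>subsimplices T. \<forall>\<eta>\<in>B k F. \<forall>c.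
        ext k F T (form_scale c \<eta>) = form_scale c (ext k F T \<eta>)) \<and>
     (\<forall>k. \<forall>F\<in>\<T>. \<forall>\<eta>\<in>B k F. ext k F F \<eta> = \<eta>) \<and>
     (\<forall>k. \<forall>T\<in>\<T>. \<forall>F\<in>subsimplices T. \<forall>f\<in>subsimplices F. \<forall>\<eta>\<in>B k f.
        tr F (ext k f T \<eta>) = ext k f F \<eta>) \<and>
     (\<forall>k. \<forall>T\<in>\<T>. \<forall>F\<in>subsimplices T. \<forall>G\<in>subsimplices T. F \<notin> subsimplices G \<longrightarrow>
        (\<forall>\<eta>\<in>B k F. tr G (ext k F T \<eta>) = 0)))"

definition Ext :: "(int \<Rightarrow> 'a set \<Rightarrow> 'a set \<Rightarrow> 'a form \<Rightarrow> 'a form) \<Rightarrow>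
    'a::euclidean_space set set \<Rightarrow> int \<Rightarrow> 'a set \<Rightarrow> 'a form \<Rightarrow> 'a form_family" where
  "Ext ext \<T> k F \<eta> = (\<lambda>T. if T \<in> \<T> \<and> F \<in> subsimplices T then ext k F T \<eta> else 0)"


section \<open>Internal direct sums\<close>

text \<open>For linear subspaces \<open>S i\<close>, the space \<open>X\<close> is their internal direct sum iff the summation map
  from the external direct sum is a bijection onto \<open>X\<close>.\<close>

definition external_sum :: "'i set \<Rightarrow> ('i \<Rightarrow> 'b::comm_monoid_add set) \<Rightarrow> ('i \<Rightarrow> 'b) set" where
  "external_sum I S =
     {f. (\<forall>i\<in>I. f i \<in> S i) \<and> (\<forall>i. i \<notin> I \<longrightarrow> f i = 0) \<and> finite {i. f i \<noteq> 0}}"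

definition is_direct_sum :: "'b::comm_monoid_add set \<Rightarrow> 'i set \<Rightarrow> ('i \<Rightarrow> 'b set) \<Rightarrow> bool" where
  "is_direct_sum X I S \<longleftrightarrow> bij_betw (\<lambda>f. \<Sum>i | f i \<noteq> 0. f i) (external_sum I S) X"

end

theory Submission
  imports Defs "Jordan_Normal_Form.Determinant"
begin

text \<open>
  A Whitney form on \<open>T\<close> is determined by its integrals over the \<open>k\<close>-dimensional faces of \<open>T\<close>: the
  form \<open>\<phi>\<^sub>\<rho>\<close> restricts to a nonzero constant volume form on the face with vertices \<open>\<rho>\<close> and to zero on every
  other \<open>k\<close>-face.  Hence every \<open>\<omega>\<close> agrees with a unique Whitney form \<open>w\<close> in all integrals over
  \<open>k\<close>-simplices.  The difference \<open>\<omega> - w\<close> vanishes on simplices of dimension less than \<open>k\<close>.  If a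
  family vanishes on simplices of dimension less than \<open>m\<close>, then its components on the \<open>m\<close>-simplices
  have vanishing traces, so they are bubbles (with zero integral when \<open>m = k\<close>).  Subtracting
  their extensions gives a family that vanishes on simplices of dimension at most \<open>m\<close>; iterating over
  \<open>m\<close> exhausts \<open>\<omega> - w\<close>.  Conversely, in a sum that is zero, integration over \<open>k\<close>-simplices
  isolates the Whitney part, and a bubble on a simplex of least dimension is isolated by
  restriction to that simplex.
\<close>

section \<open>Wedge products as determinants\<close>

hide_const (open) Determinants.det

text \<open>The integral condition in \<open>bubble0_forms\<close> is what makes the sum direct: on
  a \<open>k\<close>-simplex the Whitney volume form has vanishing traces on all proper faces, so it
  would otherwise be counted twice. The filtration by dimension works because
  \<open>Ext ext \<T> k F \<eta>\<close> is \<open>\<eta>\<close> on \<open>F\<close> and zero on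
  every simplex that does not contain \<open>F\<close>. Among simplices of dimension at most
  \<open>aff_dim F\<close> it is therefore seen on \<open>F\<close> alone, and its behaviour on
  larger simplices never has to be computed. The complex may be infinite, even around a single
  simplex, whereas families have finite support. The Whitney family of a \<open>k\<close>-simplex
  \<open>F\<close> lives on all simplices containing \<open>F\<close>, so it is a member of the
  space only if there are finitely many of them. Interpolation therefore uses only those
  \<open>F\<close> with \<open>\<omega> F \<noteq> 0\<close>: then \<open>\<omega> T\<close> is
  nonzero on every \<open>T\<close> containing \<open>F\<close>, as its trace on \<open>F\<close>
  is, and the support of \<open>\<omega>\<close> bounds the number of such \<open>T\<close>.\<close>

lemma wedge_eq_det:
  assumes "length ws = length as"
  shows "wedge as ws = Determinant.det (mat (length as) (length as) (\<lambda>(i, j). (as ! i) (ws ! j)))"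
proof -
  have "(\<Prod>i<length as. (as ! i) (ws ! p i)) = (\<Prod>i<length as.
      mat (length as) (length as) (\<lambda>(i, j). (as ! i) (ws ! j)) $$ (i, p i))"
    if "p permutes {..<length as}" for p
  proof (rule prod.cong)
    fix i assume "i \<in> {..<length as}"
    moreover from this have "p i < length as"
      using permutes_in_image[OF that, of i] by simp
    ultimately show "(as ! i) (ws ! p i) =
        mat (length as) (length as) (\<lambda>(i, j). (as ! i) (ws ! j)) $$ (i, p i)"
      by simp
  qed auto
  then show ?thesis
    using assms unfolding wedge_def Determinant.det_def
    by (simp add: atLeast0LessThan)
qed

text \<open>Laplace expansion along the first column. It is the source of the alternating sum in the
  Whitney forms.\<close>

lemma wedge_Cons:
  assumes "length as = Suc (length ws)"
  shows "wedge as (w # ws) =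
    (\<Sum>i<length as. (-1) ^ i * (as ! i) w * wedge (take i as @ drop (Suc i) as) ws)"
proof -
  let ?n = "length as"
  let ?M = "mat ?n ?n (\<lambda>(i, j). (as ! i) ((w # ws) ! j))"
  have "wedge as (w # ws) = Determinant.det ?M"
    using assms by (subst wedge_eq_det) auto
  also have "\<dots> = (\<Sum>i<?n. ?M $$ (i, 0) * cofactor ?M i 0)"
    using assms by (intro laplace_expansion_column) auto
  also have "\<dots> = (\<Sum>i<?n. (-1) ^ i * (as ! i) w * wedge (take i as @ drop (Suc i) as) ws)"
  proof (rule sum.cong)
    fix i assume "i \<in> {..<?n}"
    then have i: "i < ?n" by simp
    have "mat_delete ?M i 0 =
        mat (?n - 1) (?n - 1) (\<lambda>(i', j). ((take i as @ drop (Suc i) as) ! i') (ws ! j))"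
      unfolding mat_delete_def using i assms
      by (intro eq_matI) (auto simp: nth_append min_def)
    then have "wedge (take i as @ drop (Suc i) as) ws = Determinant.det (mat_delete ?M i 0)"
      using i assms by (subst wedge_eq_det) auto
    then show "?M $$ (i, 0) * cofactor ?M i 0 =
        (-1) ^ i * (as ! i) w * wedge (take i as @ drop (Suc i) as) ws"
      using i assms by (simp add: cofactor_def)
  qed simp
  finally show ?thesis .
qed

lemma wedge_repeated:
  assumes "i < j" "j < length ws" "ws ! i = ws ! j"
  shows "wedge as ws = 0"
proof (cases "length ws = length as")
  case True
  then show ?thesis using assms
    by (subst wedge_eq_det, simp, subst det_identical_columns[of _ "length as" i j])
       (auto intro!: eq_vecI)
qed (simp add: wedge_def)

text \<open>A zero row kills the determinant. This is how Whitney forms vanish on faces that miss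
  one of their vertices.\<close>

lemma wedge_zero_covector:
  assumes "a \<in> set as" "\<And>w. w \<in> set ws \<Longrightarrow> a w = 0"
  shows "wedge as ws = 0"
proof (cases "length ws = length as")
  case True
  obtain i where i: "i < length as" "as ! i = a"
    using assms(1) by (auto simp: in_set_conv_nth)
  have "(\<Prod>i<length as. (as ! i) (ws ! p i)) = 0" if "p permutes {..<length as}" for p
    using i assms(2) True permutes_in_image[OF that, of i]
    by (intro prod_zero) (auto intro!: bexI[of _ i])
  then show ?thesis
    unfolding wedge_def by (auto intro!: sum.neutral)
qed (simp add: wedge_def)

lemma wedge_cong:
  assumes "length as = length bs"
    "\<And>i w. i < length as \<Longrightarrow> w \<in> set ws \<Longrightarrow> (as ! i) w = (bs ! i) w"
  shows "wedge as ws = wedge bs ws"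
proof (cases "length ws = length bs")
  case True
  have "(\<Prod>i<length bs. (as ! i) (ws ! p i)) = (\<Prod>i<length bs. (bs ! i) (ws ! p i))"
    if "p permutes {..<length bs}" for p
    using assms True permutes_in_image[OF that] by (intro prod.cong) auto
  then show ?thesis
    using assms(1) unfolding wedge_def by (auto intro!: sum.cong)
qed (use assms(1) in \<open>simp add: wedge_def\<close>)

text \<open>The sign depends only on the permutation of the labels, so one \<open>s\<close> serves
  all labellings \<open>f\<close> and all vectors. This uniformity matters because the covectors of
  a Whitney form vary with the point.\<close>

lemma wedge_permute:
  assumes "mset us' = mset us"
  obtains s :: real where "s = 1 \<or> s = -1"
    "\<And>f :: 'b \<Rightarrow> 'c \<Rightarrow> real. \<And>ws. wedge (map f us') ws = s * wedge (map f us) ws"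
proof -
  obtain p where p: "p permutes {..<length us}" "permute_list p us = us'"
    using mset_eq_permutation[OF assms] by blast
  show thesis
  proof (rule that[of "of_int (sign p)"])
    show "real_of_int (sign p) = 1 \<or> real_of_int (sign p) = -1"
      by (auto simp: sign_def)
  next
    fix f :: "'b \<Rightarrow> 'c \<Rightarrow> real" and ws
    show "wedge (map f us') ws = of_int (sign p) * wedge (map f us) ws"
    proof (cases "length ws = length us")
      case True
      let ?n = "length us"
      let ?M = "mat ?n ?n (\<lambda>(i, j). f (us ! i) (ws ! j))"
      have l: "length us' = ?n" using p by auto
      have "us' ! i = us ! p i" if "i < ?n" for i
        using p that permute_list_nth[OF p(1)] by auto
      then have M: "mat ?n ?n (\<lambda>(i, j). f (us' ! i) (ws ! j)) = mat ?n ?n (\<lambda>(i, j). ?M $$ (p i, j))"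
        using permutes_in_image[OF p(1)] by (intro eq_matI) auto
      have "wedge (map f us') ws = Determinant.det (mat ?n ?n (\<lambda>(i, j). ?M $$ (p i, j)))"
        unfolding M[symmetric] using True l
        by (subst wedge_eq_det) (auto intro!: arg_cong[where f = Determinant.det] eq_matI)
      also have "\<dots> = of_int (sign p) * Determinant.det ?M"
        using p by (subst det_permute_rows) (auto simp: atLeast0LessThan)
      also have "Determinant.det ?M = wedge (map f us) ws"
        using True by (subst wedge_eq_det) (auto intro!: arg_cong[where f = Determinant.det] eq_matI)
      finally show ?thesis .
    next
      case False
      then show ?thesis using p by (auto simp: wedge_def)
    qed
  qed
qed

lemma alternating_form_wedge:
  fixes as :: "('a::euclidean_space \<Rightarrow> real) list"
  assumes "\<And>a. a \<in> set as \<Longrightarrow> linear a"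
  shows "alternating_form (int (length as)) (wedge as)"
  unfolding alternating_form_def
proof (intro conjI allI impI)
  fix ws :: "'a list" and c assume c: "c < length ws"
  show "linear (\<lambda>v. wedge as (ws[c := v]))"
  proof (cases "length ws = length as")
    case True
    let ?n = "length as"
    let ?M = "\<lambda>v. mat ?n ?n (\<lambda>(i, j). (as ! i) (ws[c := v] ! j))"
    \<comment> \<open>Only column \<open>c\<close> depends on \<open>v\<close>. Deleting it makes
      the cofactors constant, so expansion along that column is visibly linear in
      \<open>v\<close>.\<close>
    have "mat_delete (?M v) i c = mat_delete (?M 0) i c" for v i
    proof (rule eq_matI)
      fix i' j' assume "i' < dim_row (mat_delete (?M 0) i c)" "j' < dim_col (mat_delete (?M 0) i c)"
      then show "mat_delete (?M v) i c $$ (i', j') = mat_delete (?M 0) i c $$ (i', j')"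
        by (cases "j' < c") (auto simp: mat_delete_def)
    qed auto
    then have cof: "cofactor (?M v) i c = cofactor (?M 0) i c" for v i
      unfolding cofactor_def by metis
    have "wedge as (ws[c := v]) = (\<Sum>i<?n. (as ! i) v * cofactor (?M 0) i c)" for v
    proof -
      have "wedge as (ws[c := v]) = Determinant.det (?M v)"
        using True by (subst wedge_eq_det) auto
      also have "\<dots> = (\<Sum>i<?n. ?M v $$ (i, c) * cofactor (?M v) i c)"
        using True c by (intro laplace_expansion_column) auto
      also have "\<dots> = (\<Sum>i<?n. (as ! i) v * cofactor (?M 0) i c)"
        unfolding cof[of v] using True c by (intro sum.cong) auto
      finally show ?thesis .
    qed
    moreover have "linear (\<lambda>v. \<Sum>i<?n. (as ! i) v * cofactor (?M 0) i c)"
    proof (intro linear_compose_sum ballI)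
      fix i assume "i \<in> {..<?n}"
      then have "linear (as ! i)" using assms by simp
      then show "linear (\<lambda>v. (as ! i) v * cofactor (?M 0) i c)"
        by (simp add: linear_iff algebra_simps)
    qed
    ultimately show ?thesis by presburger
  next
    case False
    then show ?thesis by (simp add: wedge_def linear_iff)
  qed
next
  fix ws :: "'a list" and i j
  assume "j < length ws" "i < j" "ws ! i = ws ! j"
  then show "wedge as ws = 0" by (intro wedge_repeated)
qed (simp add: wedge_def)

lemma wedge_upper_triangular:
  assumes "length ws = length as"
    "\<And>i j. i < length as \<Longrightarrow> j < i \<Longrightarrow> (as ! i) (ws ! j) = 0"
    "\<And>i. i < length as \<Longrightarrow> (as ! i) (ws ! i) = 1"
  shows "wedge as ws = 1"
proof -
  have "wedge as ws =
      prod_list (diag_mat (mat (length as) (length as) (\<lambda>(i, j). (as ! i) (ws ! j))))"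
    using assms
    by (subst wedge_eq_det, simp, subst det_upper_triangular)
       (auto simp: upper_triangular_def)
  also have "\<dots> = 1"
    using assms(3) by (simp add: prod_list_diag_prod)
  finally show ?thesis .
qed

section \<open>Barycentric coordinates\<close>

text \<open>The barycentric coordinate of the vertex \<open>v\<close> is extended affinely from the affine hull of \<open>V\<close> to
  the ambient space, which provides smooth ambient forms.  It is indexed by the vertex and not by a
  number, since the vertex orderings of a simplex and of its faces are unrelated.\<close>

definition dcoord :: "'a::euclidean_space set \<Rightarrow> 'a \<Rightarrow> 'a \<Rightarrow> real" where
  "dcoord V v = (SOME g. linear g \<and> (\<forall>u\<in>V - {v}. g (u - v) = -1))"

definition coord :: "'a::euclidean_space set \<Rightarrow> 'a \<Rightarrow> 'a \<Rightarrow> real" where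
  "coord V v x = 1 + dcoord V v (x - v)"

text \<open>The edges \<open>u - v\<close> at a vertex are linearly independent, so a linear
  functional with prescribed values on them exists. The value \<open>-1\<close> is the drop of the
  coordinate from \<open>1\<close> at \<open>v\<close> to \<open>0\<close> at
  \<open>u\<close>.\<close>

lemma dcoord_props:
  assumes "\<not> affine_dependent V" "v \<in> V"
  shows "linear (dcoord V v)" "\<And>u. u \<in> V - {v} \<Longrightarrow> dcoord V v (u - v) = -1"
proof -
  have "independent ((\<lambda>x. - v + x) ` (V - {v}))"
    using assms affine_dependent_iff_dependent2 by blast
  from linear_independent_extend[OF this, of "\<lambda>_. -1::real"]
  have "\<exists>g :: 'a \<Rightarrow> real. linear g \<and> (\<forall>u\<in>V - {v}. g (u - v) = -1)" by auto
  from someI_ex[OF this]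
  show "linear (dcoord V v)" "\<And>u. u \<in> V - {v} \<Longrightarrow> dcoord V v (u - v) = -1"
    unfolding dcoord_def by blast+
qed

context
  fixes V :: "'a::euclidean_space set" and v
  assumes V: "\<not> affine_dependent V" "v \<in> V"
begin

lemma coord_add: "coord V v (x + w) = coord V v x + dcoord V v w"
proof -
  have "dcoord V v ((x - v) + w) = dcoord V v (x - v) + dcoord V v w"
    using dcoord_props(1)[OF V] linear_add by blast
  then show ?thesis by (simp add: coord_def algebra_simps)
qed

lemma coord_vertex: "u \<in> V \<Longrightarrow> coord V v u = (if u = v then 1 else 0)"
  using dcoord_props[OF V] by (auto simp: coord_def linear_0)

lemma coord_eq: "coord V v x = coord V v 0 + dcoord V v x"
  using coord_add[of 0 x] by simp

lemma coord_affine_combination: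
  assumes "sum c I = 1"
  shows "coord V v (\<Sum>i\<in>I. c i *\<^sub>R x i) = (\<Sum>i\<in>I. c i * coord V v (x i))"
proof -
  have "coord V v (\<Sum>i\<in>I. c i *\<^sub>R x i) = coord V v 0 * sum c I + (\<Sum>i\<in>I. c i * dcoord V v (x i))"
    using dcoord_props(1)[OF V] assms
    by (simp add: coord_eq[of "sum _ _"] linear_sum linear_scale)
  also have "\<dots> = (\<Sum>i\<in>I. c i * coord V v (x i))"
    by (simp add: coord_eq[of "x _"] distrib_left sum.distrib sum_distrib_right mult.commute)
  finally show ?thesis .
qed

end

text \<open>Both sides are affine in \<open>x\<close> and agree at the vertices of \<open>W\<close>.
  All restrictions to faces rest on this fact, without any matching of vertex numberings.\<close>

lemma coord_face:
  assumes V: "\<not> affine_dependent V" "v \<in> V" and "W \<subseteq> V" "x \<in> affine hull W"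
  shows "coord V v x = (if v \<in> W then coord W v x else 0)"
proof -
  have W: "\<not> affine_dependent W" "finite W"
    using V(1) assms(3) affine_dependent_subset aff_independent_finite by blast+
  obtain c where c: "sum c W = 1" "(\<Sum>u\<in>W. c u *\<^sub>R u) = x"
    using assms(4) W(2) by (auto simp: affine_hull_finite)
  have *: "(\<Sum>u\<in>W. c u * coord V v u) = (if v \<in> W then c v else 0)"
    using assms(3) W(2) by (subst sum.cong[OF refl, of _ _ "\<lambda>u. if u = v then c u else 0"])
      (auto simp: coord_vertex[OF V] sum.delta)
  show ?thesis
  proof (cases "v \<in> W")
    case True
    have "coord W v x = (\<Sum>u\<in>W. c u * coord W v u)"
      unfolding c(2)[symmetric] by (rule coord_affine_combination[OF W(1) True c(1)])
    also have "\<dots> = (\<Sum>u\<in>W. c u * coord V v u)"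
      using assms(3) by (intro sum.cong) (auto simp: coord_vertex[OF V] coord_vertex[OF W(1) True])
    finally show ?thesis
      using True coord_affine_combination[OF V c(1), of id] c(2) by simp
  next
    case False
    then show ?thesis using coord_affine_combination[OF V c(1), of id] c(2) * by simp
  qed
qed

text \<open>The affine function \<open>coord\<close>, evaluated at an affine combination of the
  vertices, returns its coefficient at \<open>vs ! i\<close>. This settles existence and uniqueness
  in the definite description together; outside the affine hull no representation of
  \<open>x\<close> exists.\<close>

lemma bary_eq_coord:
  assumes vs: "distinct vs" "\<not> affine_dependent (set vs)" "i < length vs"
    and x: "x \<in> affine hull set vs"
  shows "bary vs i x = coord (set vs) (vs ! i) x"
  unfolding bary_def
proof (rule the_equality)
  have bij: "bij_betw ((!) vs) {..<length vs} (set vs)"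
    using vs(1) by (simp add: bij_betw_nth)
  have val: "coord (set vs) (vs ! i) (\<Sum>j<length vs. c j *\<^sub>R vs ! j) = c i"
    if "(\<Sum>j<length vs. c j) = 1" for c
  proof -
    have "coord (set vs) (vs ! i) (\<Sum>j<length vs. c j *\<^sub>R vs ! j) =
        (\<Sum>j<length vs. c j * coord (set vs) (vs ! i) (vs ! j))"
      using vs that by (intro coord_affine_combination) auto
    also have "\<dots> = (\<Sum>j<length vs. if j = i then c j else 0)"
      using vs by (intro sum.cong) (auto simp: coord_vertex nth_eq_iff_index_eq)
    also have "\<dots> = c i" using vs(3) by simp
    finally show ?thesis .
  qed
  obtain u where u: "sum u (set vs) = 1" "(\<Sum>v\<in>set vs. u v *\<^sub>R v) = x"
    using x by (auto simp: affine_hull_finite)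
  have c: "(\<Sum>j<length vs. u (vs ! j)) = 1" "(\<Sum>j<length vs. u (vs ! j) *\<^sub>R vs ! j) = x"
    using sum.reindex_bij_betw[OF bij, of u] sum.reindex_bij_betw[OF bij, of "\<lambda>v. u v *\<^sub>R v"] u
    by simp_all
  show "\<exists>c. (\<Sum>j<length vs. c j) = 1 \<and> (\<Sum>j<length vs. c j *\<^sub>R vs ! j) = x \<and>
      c i = coord (set vs) (vs ! i) x"
    using c val[OF c(1)] by auto
  show "t = coord (set vs) (vs ! i) x"
    if "\<exists>c. (\<Sum>j<length vs. c j) = 1 \<and> (\<Sum>j<length vs. c j *\<^sub>R vs ! j) = x \<and> c i = t" for t
    using that val by auto
qed

text \<open>\<open>dbary\<close> evaluates a barycentric coordinate at a vertex displaced by a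
  tangent vector, and that point must not leave the affine hull.\<close>

lemma affine_hull_plus_tangent:
  assumes "w \<in> tangent T" "x \<in> affine hull T"
  shows "x + w \<in> affine hull T"
proof -
  \<comment> \<open>The translations preserving the affine hull form a subspace, so only the
    generators of the tangent space have to be checked.\<close>
  let ?S = "{w. \<forall>x\<in>affine hull T. x + w \<in> affine hull T}"
  have "subspace ?S"
  proof (rule subspaceI)
    fix w c assume w: "w \<in> ?S"
    have "x + c *\<^sub>R w \<in> affine hull T" if "x \<in> affine hull T" for x
    proof -
      have "(1 - c) *\<^sub>R x + c *\<^sub>R (x + w) \<in> affine hull T"
        using w that by (intro mem_affine[OF affine_affine_hull]) auto
      then show ?thesis by (simp add: algebra_simps)
    qed
    then show "c *\<^sub>R w \<in> ?S" by simp
  qed (auto simp: add.assoc[symmetric])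
  moreover have "{x - y | x y. x \<in> T \<and> y \<in> T} \<subseteq> ?S"
  proof clarify
    fix y z x assume "y \<in> T" "z \<in> T" "x \<in> affine hull T"
    then have "1 *\<^sub>R x + 1 *\<^sub>R y + (-1) *\<^sub>R z \<in> affine hull T"
      by (intro mem_affine_3[OF affine_affine_hull]) (auto simp: hull_inc)
    then show "x + (y - z) \<in> affine hull T" by (simp add: add_diff_eq)
  qed
  ultimately have "tangent T \<subseteq> ?S"
    unfolding tangent_def by (rule span_minimal[rotated])
  then show ?thesis using assms by blast
qed

lemma tangent_mono: "F \<subseteq> T \<Longrightarrow> tangent F \<subseteq> tangent T"
  unfolding tangent_def by (rule span_mono) blast

lemma dbary_eq_dcoord:
  assumes "distinct vs" "\<not> affine_dependent (set vs)" "i < length vs"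
    and "T = convex hull set vs" "w \<in> tangent T"
  shows "dbary vs i w = dcoord (set vs) (vs ! i) w"
proof -
  have *: "vs ! 0 \<in> affine hull set vs" 
    using assms(3) by (intro hull_inc nth_mem) auto
  moreover have "vs ! 0 + w \<in> affine hull set vs"
    using affine_hull_plus_tangent[OF assms(5)] * assms(4) by (simp add: affine_hull_convex_hull)
  ultimately show ?thesis
    unfolding dbary_def using assms(1-3) by (simp add: bary_eq_coord coord_add)
qed

lemma dcoord_face:
  assumes "\<not> affine_dependent V" "v \<in> V" "W \<subseteq> V" "w \<in> tangent (convex hull W)" "W \<noteq> {}"
  shows "dcoord V v w = (if v \<in> W then dcoord W v w else 0)"
proof -
  obtain x where x: "x \<in> W" using assms(5) by blast
  have W: "\<not> affine_dependent W"
    using assms(1,3) affine_dependent_subset by blast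
  have h: "x \<in> affine hull W" "x + w \<in> affine hull W"
    using x affine_hull_plus_tangent[OF assms(4)]
    by (auto simp: affine_hull_convex_hull hull_inc)
  have "dcoord V v w = coord V v (x + w) - coord V v x"
    by (simp add: coord_add assms)
  also have "\<dots> = (if v \<in> W then coord W v (x + w) - coord W v x else 0)"
    using h assms(1-3) by (simp add: coord_face)
  also have "\<dots> = (if v \<in> W then dcoord W v w else 0)"
    using W by (simp add: coord_add)
  finally show ?thesis .
qed

section \<open>Vertices, faces and tangent spaces of simplices\<close>

definition verts :: "'a::euclidean_space set \<Rightarrow> 'a set" where
  "verts T = {v. v extreme_point_of T}"

lemma verts_convex_hull: "\<not> affine_dependent V \<Longrightarrow> verts (convex hull V) = V"
  unfolding verts_def by (auto simp: extreme_point_of_convex_hull_affine_independent)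

lemma nondeg_simplexD:
  assumes "nondeg_simplex T"
  shows "\<not> affine_dependent (verts T)" "T = convex hull verts T" "verts T \<noteq> {}"
    "finite (verts T)" "int (card (verts T)) = aff_dim T + 1" "convex T" "0 \<le> aff_dim T"
    "affine hull T = affine hull verts T" "compact T"
proof -
  obtain n where n: "n simplex T" "T \<noteq> {}"
    using assms unfolding nondeg_simplex_def by blast
  then obtain C where C: "finite C" "\<not> affine_dependent C" "int (card C) = n + 1" "T = convex hull C"
    by (auto simp: simplex)
  have v: "verts T = C" using C verts_convex_hull by blast
  show "\<not> affine_dependent (verts T)" "T = convex hull verts T" "verts T \<noteq> {}"
    "finite (verts T)" "int (card (verts T)) = aff_dim T + 1" "convex T" "compact T"
    "affine hull T = affine hull verts T"
    unfolding v using C n aff_dim_simplex[OF n(1)]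
    by (auto simp: finite_imp_compact_convex_hull affine_hull_convex_hull)
  show "0 \<le> aff_dim T" using n(2) aff_dim_negative_iff[of T] by linarith
qed

lemma nondeg_simplex_convex_hull:
  assumes "\<not> affine_dependent V" "V \<noteq> {}"
  shows "nondeg_simplex (convex hull V)"
  unfolding nondeg_simplex_def using assms simplex_convex_hull[of V "int (card V) - 1"] by auto

lemma subsimplex_iff:
  assumes "nondeg_simplex T"
  shows "F \<in> subsimplices T \<longleftrightarrow> (\<exists>W. W \<noteq> {} \<and> W \<subseteq> verts T \<and> F = convex hull W)"
proof -
  note T = nondeg_simplexD[OF assms]
  have "F face_of T \<longleftrightarrow> (\<exists>W\<subseteq>verts T. F = convex hull W)"
    by (subst T(2), subst face_of_convex_hull_affine_independent) (use T(1) in auto)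
  then show ?thesis unfolding subsimplices_def mem_Collect_eq by (metis convex_hull_eq_empty)
qed

lemma subsimplexD:
  assumes "nondeg_simplex T" "F \<in> subsimplices T"
  shows "nondeg_simplex F" "verts F \<subseteq> verts T" "F \<subseteq> T" "tangent F \<subseteq> tangent T"
    "F \<noteq> T \<Longrightarrow> aff_dim F < aff_dim T"
proof -
  note T = nondeg_simplexD[OF assms(1)]
  obtain W where W: "W \<noteq> {}" "W \<subseteq> verts T" "F = convex hull W"
    using assms(2) unfolding subsimplex_iff[OF assms(1)] by blast
  have i: "\<not> affine_dependent W" using T(1) W(2) affine_dependent_subset by blast
  show "nondeg_simplex F" "verts F \<subseteq> verts T"
    unfolding W(3) verts_convex_hull[OF i]
    by (rule nondeg_simplex_convex_hull[OF i W(1)], rule W(2))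
  show "F \<subseteq> T" using assms(2) face_of_imp_subset unfolding subsimplices_def by blast
  then show "tangent F \<subseteq> tangent T" by (rule tangent_mono)
  show "F \<noteq> T \<Longrightarrow> aff_dim F < aff_dim T"
    using assms(2) T(6) face_of_aff_dim_lt unfolding subsimplices_def by blast
qed

lemma subsimplices_iff_verts:
  assumes "nondeg_simplex T" "nondeg_simplex F"
  shows "F \<in> subsimplices T \<longleftrightarrow> verts F \<subseteq> verts T"
  using assms subsimplexD(2) subsimplex_iff nondeg_simplexD(2,3) by metis

text \<open>The edges from one fixed vertex span the tangent space, and there is one edge for each
  other vertex.\<close>

lemma dim_tangent_le:
  assumes "nondeg_simplex T"
  shows "int (dim (tangent T)) \<le> aff_dim T"
proof -
  note T = nondeg_simplexD[OF assms]
  obtain a where a: "a \<in> verts T" using T(3) by blast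
  let ?S = "(\<lambda>x. x - a) ` (verts T - {a})"
  have S: "{x - a | x. x \<in> verts T - {a}} = ?S" by auto
  have "w \<in> span ?S" if "w \<in> tangent T" for w
  proof -
    have "a + w \<in> affine hull verts T"
      using affine_hull_plus_tangent[OF that, of a] a T(8) by (simp add: hull_inc)
    then show ?thesis unfolding affine_hull_span[OF a] S by auto
  qed
  then have "dim (tangent T) \<le> card ?S"
    using T(4) by (intro dim_le_card) auto
  also have "\<dots> \<le> card (verts T - {a})"
    using T(4) by (intro card_image_le) auto
  also have "\<dots> = card (verts T) - 1" using a T(4) by simp
  finally show ?thesis using T(5) a T(4) card_gt_0_iff[of "verts T"] by auto
qed

section \<open>Smoothness of polynomial forms\<close>

lemma vertex_orderingD:
  assumes "vertex_ordering T vs"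
  shows "distinct vs" "set vs = verts T"
  using assms by (auto simp: vertex_ordering_def verts_def)

lemma C_k_Suc_imp: "C_k (Suc n) f \<Longrightarrow> C_k n f"
proof (induction n arbitrary: f)
  case 0
  then show ?case
    by (auto intro!: continuous_at_imp_continuous_on dest: has_derivative_continuous)
next
  case (Suc n)
  then show ?case by (metis C_k.simps(2))
qed

lemma C_k_const: "C_k n (\<lambda>_. c)"
proof (induction n arbitrary: c)
  case (Suc n)
  then show ?case by (auto intro!: exI[of _ "\<lambda>_ _. 0"])
qed simp

lemma C_k_linear:
  assumes "linear f"
  shows "C_k n f"
proof (cases n)
  case 0
  then show ?thesis using assms by (simp add: linear_continuous_on linear_conv_bounded_linear)
next
  case (Suc m)
  then show ?thesis using assms C_k_const
    by (auto intro!: exI[of _ "\<lambda>_. f"] linear_imp_has_derivative)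
qed

lemma C_k_add: "C_k n f \<Longrightarrow> C_k n g \<Longrightarrow> C_k n (\<lambda>x. f x + g x)"
proof (induction n arbitrary: f g)
  case (Suc n)
  obtain f' g' where "\<And>x. (f has_derivative f' x) (at x)" "\<And>v. C_k n (\<lambda>x. f' x v)"
    "\<And>x. (g has_derivative g' x) (at x)" "\<And>v. C_k n (\<lambda>x. g' x v)"
    using Suc.prems by auto
  then show ?case using Suc.IH
    by (auto intro!: exI[of _ "\<lambda>x v. f' x v + g' x v"] derivative_intros)
qed (auto intro: continuous_intros)

lemma C_k_mult: "C_k n f \<Longrightarrow> C_k n g \<Longrightarrow> C_k n (\<lambda>x. f x * g x)"
proof (induction n arbitrary: f g)
  case (Suc n)
  obtain f' g' where *: "\<And>x. (f has_derivative f' x) (at x)" "\<And>v. C_k n (\<lambda>x. f' x v)"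
    "\<And>x. (g has_derivative g' x) (at x)" "\<And>v. C_k n (\<lambda>x. g' x v)"
    using Suc.prems by auto
  have "C_k n (\<lambda>x. f x * g' x v + f' x v * g x)" for v
    using Suc.prems[THEN C_k_Suc_imp] * by (intro C_k_add Suc.IH)
  moreover have "((\<lambda>x. f x * g x) has_derivative (\<lambda>v. f x * g' x v + f' x v * g x)) (at x)" for x
    using * by (intro has_derivative_mult)
  ultimately show ?case unfolding C_k.simps
    by (intro exI[of _ "\<lambda>x v. f x * g' x v + f' x v * g x"]) simp
qed (auto intro: continuous_intros)

lemma C_k_power: "C_k n f \<Longrightarrow> C_k n (\<lambda>x. f x ^ m)"
  by (induction m) (auto intro: C_k_const C_k_mult)

lemma C_k_prod: "(\<And>i. i \<in> I \<Longrightarrow> C_k n (f i)) \<Longrightarrow> C_k n (\<lambda>x. \<Prod>i\<in>I. f i x)"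
  by (induction I rule: infinite_finite_induct) (auto intro: C_k_const C_k_mult)

lemma C_k_coord:
  assumes "\<not> affine_dependent V" "v \<in> V"
  shows "C_k n (coord V v)"
proof -
  have "coord V v = (\<lambda>x. coord V v 0 + dcoord V v x)"
    using coord_eq[OF assms] by blast
  then show ?thesis
    using C_k_add[OF C_k_const C_k_linear[OF dcoord_props(1)[OF assms]]] by metis
qed

lemma sum_fun_apply: "(\<Sum>i\<in>I. f i) x = (\<Sum>i\<in>I. f i x)"
  for f :: "'b \<Rightarrow> 'c \<Rightarrow> 'd::comm_monoid_add"
  by (induction I rule: infinite_finite_induct) auto

lemma subspace_smooth_ambient_forms: "form.subspace (smooth_ambient_forms k)"
proof (rule form.subspaceI)
  show "0 \<in> smooth_ambient_forms k"
    unfolding smooth_ambient_forms_def alternating_form_def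
    by (auto simp: linear_iff C_k_const)
next
  fix \<omega> \<eta> :: "'a form" assume "\<omega> \<in> smooth_ambient_forms k" "\<eta> \<in> smooth_ambient_forms k"
  then show "\<omega> + \<eta> \<in> smooth_ambient_forms k"
    unfolding smooth_ambient_forms_def alternating_form_def
    by (auto simp: C_k_add intro!: linear_compose_add)
next
  fix c and \<omega> :: "'a form" assume "\<omega> \<in> smooth_ambient_forms k"
  then show "form_scale c \<omega> \<in> smooth_ambient_forms k"
    unfolding smooth_ambient_forms_def alternating_form_def form_scale_def
    by (auto intro!: C_k_mult C_k_const linear_compose_scale_right[where 'b = real, simplified])
qed

lemma tr_add: "tr T (\<omega> + \<eta>) = tr T \<omega> + tr T \<eta>"
  and tr_scale: "tr T (form_scale c \<omega>) = form_scale c (tr T \<omega>)"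
  and tr_zero: "tr T 0 = 0"
  and tr_diff: "tr T (\<omega> - \<eta>) = tr T \<omega> - tr T \<eta>"
  by (auto simp: tr_def form_scale_def fun_eq_iff)

lemma tr_tr: "F \<subseteq> T \<Longrightarrow> tr F (tr T \<omega>) = tr F \<omega>"
  using tangent_mono[of F T] by (auto simp: tr_def fun_eq_iff)

lemma subspace_smooth_forms: "form.subspace (smooth_forms k T)"
proof (rule form.subspaceI)
  note S = subspace_smooth_ambient_forms[of k]
  show "0 \<in> smooth_forms k T"
    unfolding smooth_forms_def using form.subspace_0[OF S] tr_zero[of T] by (metis image_eqI)
  show "\<omega> + \<eta> \<in> smooth_forms k T" if "\<omega> \<in> smooth_forms k T" "\<eta> \<in> smooth_forms k T" for \<omega> \<eta>
    using that form.subspace_add[OF S] tr_add[of T] unfolding smooth_forms_def by (smt (verit) image_iff)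
  show "form_scale c \<omega> \<in> smooth_forms k T" if "\<omega> \<in> smooth_forms k T" for c \<omega>
    using that form.subspace_scale[OF S] tr_scale[of T] unfolding smooth_forms_def by (smt (verit) image_iff)
qed

lemma smooth_ambient_forms_wedge:
  assumes "\<And>n. C_k n h" "\<And>a. a \<in> set as \<Longrightarrow> linear a" "int (length as) = k"
  shows "(\<lambda>x ws. h x * wedge as ws) \<in> smooth_ambient_forms k"
proof -
  have "alternating_form k (wedge as)"
    using alternating_form_wedge[of as] assms by simp
  then have "alternating_form k (\<lambda>ws. c * wedge as ws)" for c
    unfolding alternating_form_def by (auto simp: linear_iff algebra_simps)
  then show ?thesis
    using assms(1) by (auto simp: smooth_ambient_forms_def C_k_mult C_k_const)
qed

text \<open>More vectors than dimensions are either repeated or linearly dependent. In the second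
  case one entry lies in the span of the others, and linearity in its slot reduces to lists with a
  repetition.\<close>

lemma alternating_form_eq_0:
  assumes "alternating_form k \<alpha>" "set ws \<subseteq> S" "dim S < length ws"
  shows "\<alpha> ws = 0"
proof (cases "distinct ws")
  case False
  then obtain i j where "i < length ws" "j < length ws" "i \<noteq> j" "ws ! i = ws ! j"
    by (auto simp: distinct_conv_nth)
  then show ?thesis
    using assms(1) unfolding alternating_form_def by (metis nat_neq_iff)
next
  case True
  then have "dependent (set ws)"
    using independent_card_le_dim[OF assms(2)] assms(3) distinct_card[OF True] by linarith
  then obtain a where a: "a \<in> set ws" "a \<in> span (set ws - {a})"
    unfolding dependent_def by blast
  obtain i where i: "i < length ws" "ws ! i = a"
    using a by (auto simp: in_set_conv_nth)
  have "\<alpha> (ws[i := u]) = 0" if "u \<in> set ws - {a}" for u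
  proof -
    obtain j where j: "j < length ws" "ws ! j = u" "j \<noteq> i"
      using \<open>u \<in> set ws - {a}\<close> i by (auto simp: in_set_conv_nth)
    then have "ws[i := u] ! i = ws[i := u] ! j" using i by simp
    then show ?thesis
      using assms(1) i(1) j(1,3) unfolding alternating_form_def
      by (metis length_list_update nat_neq_iff)
  qed
  moreover have "linear (\<lambda>v. \<alpha> (ws[i := v]))"
    using assms(1) i unfolding alternating_form_def by blast
  ultimately have "\<alpha> (ws[i := a]) = 0"
    using linear_eq_0_on_span[of "\<lambda>v. \<alpha> (ws[i := v])"] a(2) by blast
  then show ?thesis using i by (metis list_update_id)
qed

text \<open>No list has negative length, and above the dimension of \<open>T\<close> tangent vectors
  are dependent. This is what clears all simplices of dimension below \<open>k\<close> before the
  bubble decomposition starts.\<close>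

lemma smooth_forms_eq_0:
  assumes "nondeg_simplex T" "\<omega> \<in> smooth_forms k T" "k < 0 \<or> aff_dim T < k"
  shows "\<omega> = 0"
proof -
  obtain \<phi> where \<phi>: "\<omega> = tr T \<phi>" "\<And>x. alternating_form k (\<phi> x)"
    using assms(2) by (auto simp: smooth_forms_def smooth_ambient_forms_def)
  have "\<phi> x ws = 0" if "set ws \<subseteq> tangent T" for x ws
  proof (cases "int (length ws) = k")
    case True
    then have "dim (tangent T) < length ws"
      using dim_tangent_le[OF assms(1)] assms(3) by linarith
    then show ?thesis using alternating_form_eq_0[OF \<phi>(2) that] by blast
  next
    case False
    then show ?thesis using \<phi>(2) unfolding alternating_form_def by blast
  qed
  then show ?thesis unfolding \<phi>(1) tr_def by (auto simp: fun_eq_iff)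
qed

lemma bary_on_simplex:
  assumes "nondeg_simplex T" "vertex_ordering T vs" "i < length vs" "x \<in> T"
  shows "bary vs i x = coord (verts T) (vs ! i) x"
proof -
  have "x \<in> affine hull set vs"
    using nondeg_simplexD(8)[OF assms(1)] vertex_orderingD(2)[OF assms(2)] assms(4)
    by (metis hull_inc)
  then show ?thesis
    using bary_eq_coord[of vs i x] nondeg_simplexD(1)[OF assms(1)] vertex_orderingD[OF assms(2)]
      assms(3) by simp
qed

lemma dbary_on_simplex:
  assumes "nondeg_simplex T" "vertex_ordering T vs" "i < length vs" "w \<in> tangent T"
  shows "dbary vs i w = dcoord (verts T) (vs ! i) w"
  unfolding vertex_orderingD(2)[OF assms(2), symmetric]
proof (rule dbary_eq_dcoord)
  show "T = convex hull set vs" "\<not> affine_dependent (set vs)"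
    unfolding vertex_orderingD(2)[OF assms(2)] by (fact nondeg_simplexD[OF assms(1)])+
qed (use assms vertex_orderingD in auto)

lemma wedge_dbary:
  assumes "nondeg_simplex T" "vertex_ordering T vs" "set \<sigma> \<subseteq> {..<length vs}" "set ws \<subseteq> tangent T"
  shows "wedge (map (dbary vs) \<sigma>) ws = wedge (map (dcoord (verts T)) (map ((!) vs) \<sigma>)) ws"
proof (rule wedge_cong)
  fix i w assume i: "i < length (map (dbary vs) \<sigma>)" and w: "w \<in> set ws"
  have "\<sigma> ! i < length vs" using assms(3) i nth_mem by fastforce
  then show "(map (dbary vs) \<sigma> ! i) w = (map (dcoord (verts T)) (map ((!) vs) \<sigma>) ! i) w"
    using dbary_on_simplex[OF assms(1,2)] assms(4) i w by auto
qed simp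

text \<open>Away from the affine hull of \<open>T\<close> the functions \<open>bary\<close> are
  unspecified, so the generators as written need not be smooth ambient forms. Each is replaced by
  the one built from the globally defined \<open>coord\<close> and \<open>dcoord\<close>, which has
  the same pullback to \<open>T\<close>.\<close>

lemma poly_forms_subset_smooth_forms:
  assumes T: "nondeg_simplex T" "vertex_ordering T (vo T)"
  shows "poly_forms vo p k T \<subseteq> smooth_forms k T"
proof -
  let ?vs = "vo T" and ?V = "verts T"
  note V = nondeg_simplexD(1)[OF T(1)] and vs = vertex_orderingD[OF T(2)]
  let ?m = "\<lambda>\<alpha> x. \<Prod>i<length ?vs. coord ?V (?vs ! i) x ^ \<alpha> i"
  have m: "bary_monomial ?vs \<alpha> x = ?m \<alpha> x" if "x \<in> T" for x \<alpha>
    unfolding bary_monomial_def using bary_on_simplex[OF T _ that] by (intro prod.cong) auto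
  have mem: "?vs ! i \<in> ?V" if "i < length ?vs" for i
    using that vs(2) nth_mem by blast
  have Cm: "C_k n (?m \<alpha>)" for n \<alpha>
    using mem by (intro C_k_prod C_k_power C_k_coord[OF V]) auto
  have lin: "linear a" if "a \<in> set (map (dcoord ?V) (map ((!) ?vs) \<sigma>))" "set \<sigma> \<subseteq> {..<length ?vs}" for a \<sigma>
    using that mem by (auto intro!: dcoord_props(1)[OF V])
  have "tr T (\<lambda>x ws. bary_monomial ?vs \<alpha> x * wedge (map (dbary ?vs) \<sigma>) ws) \<in> smooth_forms k T"
    if "\<sigma> \<in> incr_tuples ?vs k" for \<alpha> \<sigma>
  proof -
    have s: "set \<sigma> \<subseteq> {..<length ?vs}" "int (length \<sigma>) = k"
      using that by (auto simp: incr_tuples_def)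
    have "tr T (\<lambda>x ws. bary_monomial ?vs \<alpha> x * wedge (map (dbary ?vs) \<sigma>) ws) =
        tr T (\<lambda>x ws. ?m \<alpha> x * wedge (map (dcoord ?V) (map ((!) ?vs) \<sigma>)) ws)"
      unfolding tr_def by (auto simp: fun_eq_iff m wedge_dbary[OF T s(1)])
    moreover have "(\<lambda>x ws. ?m \<alpha> x * wedge (map (dcoord ?V) (map ((!) ?vs) \<sigma>)) ws)
        \<in> smooth_ambient_forms k"
      using s lin Cm by (intro smooth_ambient_forms_wedge) auto
    ultimately show ?thesis by (simp add: smooth_forms_def)
  qed
  moreover have "tr T (\<lambda>x ws. bary_monomial ?vs \<alpha> x * whitney_form ?vs \<rho> x ws) \<in> smooth_forms k T"
    if "\<rho> \<in> incr_tuples ?vs (k + 1)" for \<alpha> \<rho>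
  proof -
    have s: "set \<rho> \<subseteq> {..<length ?vs}" "int (length \<rho>) = k + 1"
      using that by (auto simp: incr_tuples_def)
    let ?d = "\<lambda>i. take i \<rho> @ drop (Suc i) \<rho>"
    have d: "set (?d i) \<subseteq> {..<length ?vs}" for i
      using s(1) by (auto dest: in_set_takeD in_set_dropD)
    let ?t = "\<lambda>i x ws. ((-1) ^ i * ?m \<alpha> x * coord ?V (?vs ! (\<rho> ! i)) x) *
        wedge (map (dcoord ?V) (map ((!) ?vs) (?d i))) ws"
    have r: "\<rho> ! i < length ?vs" if "i < length \<rho>" for i using s(1) that nth_mem by fastforce
    have "tr T (\<lambda>x ws. bary_monomial ?vs \<alpha> x * whitney_form ?vs \<rho> x ws) =
        tr T (\<Sum>i<length \<rho>. ?t i)"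
      unfolding tr_def whitney_form_def
      by (auto simp: sum_fun_apply fun_eq_iff m wedge_dbary[OF T d] sum_distrib_left mult_ac
            bary_on_simplex[OF T r] simp del: map_append map_map intro!: sum.cong)
    moreover have "?t i \<in> smooth_ambient_forms k" if "i < length \<rho>" for i
    proof (rule smooth_ambient_forms_wedge)
      show "C_k n (\<lambda>x. (-1) ^ i * ?m \<alpha> x * coord ?V (?vs ! (\<rho> ! i)) x)" for n
        using that r mem Cm by (intro C_k_mult C_k_const C_k_coord[OF V]) auto
      show "linear a" if "a \<in> set (map (dcoord ?V) (map ((!) ?vs) (?d i)))" for a
        by (rule lin[OF that d])
    qed (use s that in auto)
    then have "(\<Sum>i<length \<rho>. ?t i) \<in> smooth_ambient_forms k"
      by (intro form.subspace_sum[OF subspace_smooth_ambient_forms]) auto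
    ultimately show ?thesis by (simp add: smooth_forms_def)
  qed
  ultimately show ?thesis
    by (cases p; simp; intro form.span_minimal[OF _ subspace_smooth_forms]; blast)
qed

section \<open>Integration over simplices\<close>

abbreviation std_simplex :: "nat \<Rightarrow> (nat \<Rightarrow> real) set" where
  "std_simplex n \<equiv> {t. (\<forall>i<n. 0 \<le> t i) \<and> (\<Sum>i<n. t i) \<le> 1}"

abbreviation lborel_power :: "nat \<Rightarrow> (nat \<Rightarrow> real) measure" where
  "lborel_power n \<equiv> \<Pi>\<^sub>M i\<in>{..<n}. lborel"

lemma emeasure_std_simplex_nat:
  "emeasure (lborel_power n) (std_simplex n \<inter> space (lborel_power n)) = ennreal (1 / fact n)"
  using emeasure_std_simplex_aux[of "{..<n}" 1]
  by (simp add: Ball_def divide_ennreal flip: ennreal_fact)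

text \<open>A set that is not measurable is assigned \<open>emeasure\<close> zero, but the value
  here is \<open>1 / fact n\<close>.\<close>

lemma sets_std_simplex: "std_simplex n \<inter> space (lborel_power n) \<in> sets (lborel_power n)"
proof (rule ccontr)
  assume "\<not> ?thesis"
  from emeasure_notin_sets[OF this] show False
    unfolding emeasure_std_simplex_nat by simp
qed

definition simplex_point :: "'a::euclidean_space list \<Rightarrow> (nat \<Rightarrow> real) \<Rightarrow> 'a" where
  "simplex_point vs t = vs ! 0 + (\<Sum>i<length vs - 1. t i *\<^sub>R (vs ! Suc i - vs ! 0))"

definition edge_vectors :: "'a::euclidean_space list \<Rightarrow> 'a list" where
  "edge_vectors vs = map (\<lambda>i. vs ! Suc i - vs ! 0) [0..<length vs - 1]"

lemma simplex_integral_eq: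
  "simplex_integral vs \<omega> = (LINT t : std_simplex (length vs - 1) | lborel_power (length vs - 1).
     \<omega> (simplex_point vs t) (edge_vectors vs))"
  unfolding simplex_integral_def simplex_point_def edge_vectors_def by (simp add: Let_def)

context
  fixes T :: "'a::euclidean_space set" and vs :: "'a list"
  assumes T: "nondeg_simplex T" and vs: "vertex_ordering T vs"
begin

lemma length_vertex_ordering: "int (length vs) = aff_dim T + 1"
  using nondeg_simplexD(5)[OF T] vertex_orderingD[OF vs] distinct_card by metis

lemma length_vertex_ordering_pos: "0 < length vs"
  using length_vertex_ordering nondeg_simplexD(7)[OF T] by linarith

lemma nth_vertex_ordering: "i < length vs \<Longrightarrow> vs ! i \<in> verts T"
  using vertex_orderingD(2)[OF vs] nth_mem by blast

lemma verts_subset: "verts T \<subseteq> T"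
  by (auto simp: verts_def extreme_point_of_def)

lemma simplex_point_in_simplex:
  assumes "t \<in> std_simplex (length vs - 1)"
  shows "simplex_point vs t \<in> T"
proof -
  let ?n = "length vs - 1"
  \<comment> \<open>Barycentric weights of the parametrised point: the base vertex takes what the
    other weights leave.\<close>
  let ?c = "\<lambda>i. case i of 0 \<Rightarrow> 1 - (\<Sum>i<?n. t i) | Suc i \<Rightarrow> t i"
  have "simplex_point vs t = (1 - (\<Sum>i<?n. t i)) *\<^sub>R vs ! 0 + (\<Sum>i<?n. t i *\<^sub>R vs ! Suc i)"
    unfolding simplex_point_def
    by (simp add: scaleR_diff_right sum_subtractf scaleR_diff_left scaleR_sum_left)
  also have "\<dots> = (\<Sum>i<Suc ?n. ?c i *\<^sub>R vs ! i)"
    unfolding sum.lessThan_Suc_shift by simp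
  also have "\<dots> \<in> T"
  proof (rule convex_sum)
    show "sum ?c {..<Suc ?n} = 1" unfolding sum.lessThan_Suc_shift by simp
    show "vs ! i \<in> T" if "i \<in> {..<Suc ?n}" for i
      using that nth_vertex_ordering verts_subset length_vertex_ordering_pos by force
    show "0 \<le> ?c i" if "i \<in> {..<Suc ?n}" for i
      using that assms by (cases i) auto
  qed (use nondeg_simplexD(6)[OF T] in auto)
  finally show ?thesis .
qed

lemma edge_vectors_tangent: "set (edge_vectors vs) \<subseteq> tangent T"
proof -
  have "vs ! Suc i - vs ! 0 \<in> tangent T" if "i < length vs - 1" for i
    unfolding tangent_def using that nth_vertex_ordering[of "Suc i"] nth_vertex_ordering[of 0] verts_subset
    by (intro span_base) force
  then show ?thesis by (auto simp: edge_vectors_def)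
qed

text \<open>Continuity is only available for an ambient form \<open>\<phi>\<close> representing
  \<open>\<omega>\<close>. The two agree over the standard simplex, where the integrand is bounded
  by compactness of \<open>T\<close> and the measure is finite. Integrability is needed because
  additivity of the integral depends on it.\<close>

lemma smooth_forms_integrable:
  assumes "\<omega> \<in> smooth_forms k T"
  shows "set_integrable (lborel_power (length vs - 1)) (std_simplex (length vs - 1))
    (\<lambda>t. \<omega> (simplex_point vs t) (edge_vectors vs))"
proof -
  let ?n = "length vs - 1"
  let ?M = "lborel_power ?n" and ?A = "std_simplex ?n \<inter> space (lborel_power ?n)"
  obtain \<phi> where \<phi>: "\<omega> = tr T \<phi>" "\<And>ws n. C_k n (\<lambda>x. \<phi> x ws)"
    using assms by (auto simp: smooth_forms_def smooth_ambient_forms_def)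
  let ?g = "\<lambda>x. \<phi> x (edge_vectors vs)"
  have cont: "continuous_on UNIV ?g"
    using \<phi>(2)[of 0] by simp
  have "compact (?g ` T)"
    using nondeg_simplexD(9)[OF T] cont by (intro compact_continuous_image continuous_on_subset[OF cont]) auto
  then obtain B where B: "\<And>x. x \<in> T \<Longrightarrow> norm (?g x) \<le> B"
    by (meson bounded_iff compact_imp_bounded imageI)
  have meas: "simplex_point vs \<in> borel_measurable ?M"
    unfolding simplex_point_def[abs_def] by measurable
  have "integrable ?M (\<lambda>t. indicator ?A t *\<^sub>R ?g (simplex_point vs t))"
  proof (rule integrableI_bounded_set[of ?A _ _ B])
    show "emeasure ?M ?A < \<infinity>" unfolding emeasure_std_simplex_nat by simp
    have "(\<lambda>t. ?g (simplex_point vs t)) \<in> borel_measurable ?M"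
      using measurable_compose[OF meas borel_measurable_continuous_onI[OF cont]] .
    then show "(\<lambda>t. indicator ?A t *\<^sub>R ?g (simplex_point vs t)) \<in> borel_measurable ?M"
      using sets_std_simplex by measurable
  qed (use sets_std_simplex B simplex_point_in_simplex in auto)
  moreover have "indicator (std_simplex ?n) t *\<^sub>R \<omega> (simplex_point vs t) (edge_vectors vs) =
      indicator ?A t *\<^sub>R ?g (simplex_point vs t)" if "t \<in> space ?M" for t
    using that simplex_point_in_simplex[of t] edge_vectors_tangent
    by (auto simp: \<phi>(1) tr_def indicator_def)
  ultimately show ?thesis
    unfolding set_integrable_def by (subst Bochner_Integration.integrable_cong[OF refl]) auto
qed

lemma simplex_integral_add:
  assumes "\<omega> \<in> smooth_forms k T" "\<eta> \<in> smooth_forms k T"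
  shows "simplex_integral vs (\<omega> + \<eta>) = simplex_integral vs \<omega> + simplex_integral vs \<eta>"
  using set_integral_add(2)[OF assms[THEN smooth_forms_integrable]]
  by (simp add: simplex_integral_eq)

lemma simplex_integral_constant:
  assumes "\<And>x. x \<in> T \<Longrightarrow> \<omega> x (edge_vectors vs) = c"
  shows "simplex_integral vs \<omega> = c / fact (length vs - 1)"
proof -
  let ?n = "length vs - 1"
  let ?M = "lborel_power ?n" and ?A = "std_simplex ?n \<inter> space (lborel_power ?n)"
  have "simplex_integral vs \<omega> = (LINT t|?M. indicator ?A t *\<^sub>R c)"
    unfolding simplex_integral_eq set_lebesgue_integral_def
    using assms simplex_point_in_simplex
    by (intro Bochner_Integration.integral_cong) (auto simp: indicator_def)
  also have "\<dots> = measure ?M ?A * c"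
    using sets_std_simplex by simp
  also have "measure ?M ?A = 1 / fact ?n"
    by (simp add: measure_def emeasure_std_simplex_nat)
  finally show ?thesis by simp
qed

end

lemma simplex_integral_scale: "simplex_integral vs (form_scale c \<omega>) = c * simplex_integral vs \<omega>"
  by (simp add: simplex_integral_eq form_scale_def)

section \<open>Whitney forms\<close>

text \<open>The Whitney form at \<open>x\<close> is the determinant whose columns are \<open>(\<lambda>\<^sub>u(x))\<^sub>u\<close> and \<open>(d\<lambda>\<^sub>u(w))\<^sub>u\<close> for the
  tangent vectors \<open>w\<close>.  \<^const>\<open>wedge\<close> accepts covectors on any type, so that the first
  column is represented by the additional vector \<^const>\<open>None\<close>.\<close>

definition whitney_covector :: "'a::euclidean_space set \<Rightarrow> 'a \<Rightarrow> 'a \<Rightarrow> 'a option \<Rightarrow> real" where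
  "whitney_covector V x u = case_option (coord V u x) (dcoord V u)"

definition whitney :: "'a::euclidean_space set \<Rightarrow> 'a list \<Rightarrow> 'a form" where
  "whitney V us = (\<lambda>x ws. wedge (map (whitney_covector V x) us) (None # map Some ws))"

lemma wedge_map_vectors: "wedge as (map f ws) = wedge (map (\<lambda>a. a \<circ> f) as) ws"
proof (cases "length ws = length as")
  case True
  have "(\<Prod>i<length as. (as ! i) (map f ws ! p i)) =
      (\<Prod>i<length as. (map (\<lambda>a. a \<circ> f) as ! i) (ws ! p i))"
    if "p permutes {..<length as}" for p
  proof (rule prod.cong)
    fix i assume "i \<in> {..<length as}"
    moreover from this have "p i < length as" using permutes_in_image[OF that, of i] by simp
    ultimately show "(as ! i) (map f ws ! p i) = (map (\<lambda>a. a \<circ> f) as ! i) (ws ! p i)"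
      using True by simp
  qed simp
  then show ?thesis using True by (simp add: wedge_def)
qed (simp add: wedge_def)

text \<open>Expanding the determinant along the column of \<open>None\<close> recovers the
  alternating sum of \<open>whitney_form\<close>, now indexed by vertices. When the lengths do not
  match, both sides vanish.\<close>

lemma whitney_expand:
  "whitney V us x ws = (\<Sum>i<length us. (-1) ^ i * coord V (us ! i) x *
     wedge (map (dcoord V) (take i us @ drop (Suc i) us)) ws)"
proof (cases "length us = Suc (length ws)")
  case True
  have "wedge (map (whitney_covector V x) us') (map Some ws) = wedge (map (dcoord V) us') ws" for us'
    unfolding wedge_map_vectors by (rule wedge_cong) (auto simp: whitney_covector_def)
  then show ?thesis
    unfolding whitney_def using True
    by (subst wedge_Cons) (auto simp: take_map drop_map whitney_covector_def simp flip: map_append)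
next
  case False
  then have "wedge (map (dcoord V) (take i us @ drop (Suc i) us)) ws = 0" if "i < length us" for i
    using that by (auto simp: wedge_def)
  then show ?thesis
    using False by (simp add: whitney_def) (simp add: wedge_def)
qed

lemma whitney_permute:
  assumes "mset us' = mset us"
  obtains s where "s = 1 \<or> s = -1" "whitney V us' = form_scale s (whitney V us)"
proof -
  obtain s :: real where "s = 1 \<or> s = -1"
    "\<And>f :: 'a \<Rightarrow> 'a option \<Rightarrow> real. \<And>ws. wedge (map f us') ws = s * wedge (map f us) ws"
    using wedge_permute[OF assms] by metis
  then show thesis using that by (auto simp: whitney_def form_scale_def)
qed

lemma tr_whitney_form:
  assumes "nondeg_simplex T" "vertex_ordering T vs" "set \<rho> \<subseteq> {..<length vs}"
  shows "tr T (whitney_form vs \<rho>) = tr T (whitney (verts T) (map ((!) vs) \<rho>))"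
proof -
  have d: "set (take i \<rho> @ drop (Suc i) \<rho>) \<subseteq> {..<length vs}" for i
    using assms(3) by (auto dest: in_set_takeD in_set_dropD)
  have r: "\<rho> ! i < length vs" if "i < length \<rho>" for i
    using assms(3) that nth_mem by fastforce
  show ?thesis
    unfolding tr_def whitney_form_def whitney_expand
    using wedge_dbary[OF assms(1,2) d] bary_on_simplex[OF assms(1,2) r]
    by (auto simp: fun_eq_iff take_map drop_map simp flip: map_append simp del: map_map intro!: sum.cong)
qed

text \<open>The argument goes by rows: on \<open>F\<close> the row of a vertex of \<open>F\<close>
  becomes the corresponding row for \<open>F\<close>, and the row of any other vertex becomes
  zero.\<close>

lemma tr_whitney_face:
  assumes T: "nondeg_simplex T" and F: "F \<in> subsimplices T" and us: "set us \<subseteq> verts T"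
  shows "tr F (whitney (verts T) us) = (if set us \<subseteq> verts F then tr F (whitney (verts F) us) else 0)"
proof -
  note V = nondeg_simplexD(1)[OF T] and FT = subsimplexD[OF T F]
  note FD = nondeg_simplexD[OF FT(1)]
  have c: "coord (verts T) u x = (if u \<in> verts F then coord (verts F) u x else 0)"
    if "u \<in> verts T" "x \<in> F" for u x
    using coord_face[OF V that(1) FT(2)] FD(8) that(2) by (metis hull_inc)
  have d: "dcoord (verts T) u w = (if u \<in> verts F then dcoord (verts F) u w else 0)"
    if "u \<in> verts T" "w \<in> tangent F" for u w
    using dcoord_face[OF V that(1) FT(2) _ FD(3), of w] that(2) FD(2) by metis
  have cov: "whitney_covector (verts T) x u w =
      (if u \<in> verts F then whitney_covector (verts F) x u w else 0)"
    if "x \<in> F" "set ws \<subseteq> tangent F" "w \<in> set (None # map Some ws)" "u \<in> verts T" for x ws w u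
    using that c d by (auto simp: whitney_covector_def)
  have "whitney (verts T) us x ws = (if set us \<subseteq> verts F then whitney (verts F) us x ws else 0)"
    if x: "x \<in> F" and ws: "set ws \<subseteq> tangent F" for x ws
  proof (cases "set us \<subseteq> verts F")
    case True
    have "us ! i \<in> verts F" "us ! i \<in> verts T" if "i < length us" for i
      using that True us nth_mem by blast+
    then have "whitney (verts T) us x ws = whitney (verts F) us x ws"
      unfolding whitney_def using cov[OF x ws] by (intro wedge_cong) auto
    then show ?thesis using True by simp
  next
    case False
    then obtain u where "u \<in> set us" "u \<notin> verts F" "u \<in> verts T" using us by blast
    then have "whitney (verts T) us x ws = 0"
      unfolding whitney_def using cov[OF x ws]
      by (intro wedge_zero_covector[of "whitney_covector (verts T) x u"]) auto
    then show ?thesis using False by simp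
  qed
  then show ?thesis unfolding tr_def by (auto simp: fun_eq_iff)
qed

text \<open>Moving \<open>x\<close> along an edge adds a multiple of a later column of the determinant to its first
  column, so it suffices to take \<open>x = vs ! 0\<close>, where the matrix is upper unitriangular.\<close>

lemma whitney_edge_vectors:
  assumes T: "nondeg_simplex T" "vertex_ordering T vs" and x: "x \<in> T"
  shows "whitney (verts T) vs x (edge_vectors vs) = 1"
proof -
  let ?V = "verts T" and ?es = "edge_vectors vs"
  note V = nondeg_simplexD(1)[OF T(1)] and vs = vertex_orderingD[OF T(2)]
  note nth = nth_vertex_ordering[OF T]
  have len: "0 < length vs" by (rule length_vertex_ordering_pos[OF T])
  have es: "length vs = Suc (length ?es)" "\<And>j. j < length vs - 1 \<Longrightarrow> ?es ! j = vs ! Suc j - vs ! 0"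
    using len by (auto simp: edge_vectors_def)
  have v0: "vs ! 0 \<in> ?V" using nth len by blast
  have lin: "linear a" if "a \<in> set (map (dcoord ?V) vs)" for a
    using that vs(2) dcoord_props(1)[OF V] by auto
  \<comment> \<open>The change of the determinant when \<open>x\<close> moves by \<open>w\<close>.
    It vanishes on edge vectors, because these repeat a later column.\<close>
  let ?D = "\<lambda>w. wedge (map (dcoord ?V) vs) (w # ?es)"
  have "linear (\<lambda>v. wedge (map (dcoord ?V) vs) ((0 # ?es)[0 := v]))"
    using alternating_form_wedge[OF lin] unfolding alternating_form_def by blast
  then have D: "linear ?D" by simp
  have D0: "?D e = 0" if e: "e \<in> set ?es" for e
  proof -
    obtain j where "j < length ?es" "?es ! j = e" using e by (auto simp: in_set_conv_nth)
    then show ?thesis by (intro wedge_repeated[of 0 "Suc j"]) auto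
  qed
  have split: "whitney ?V vs x ?es = whitney ?V vs y ?es + ?D (x - y)" for x y
  proof -
    have c: "coord ?V (vs ! i) x = coord ?V (vs ! i) y + dcoord ?V (vs ! i) (x - y)"
      if "i < length vs" for i
      using coord_add[OF V nth[OF that], of y "x - y"] by simp
    have "?D (x - y) = (\<Sum>i<length vs. (-1) ^ i * dcoord ?V (vs ! i) (x - y) *
        wedge (map (dcoord ?V) (take i vs @ drop (Suc i) vs)) ?es)"
      using es(1) by (subst wedge_Cons) (auto simp: take_map drop_map)
    then show ?thesis
      unfolding whitney_expand by (simp add: c algebra_simps flip: sum.distrib)
  qed
  have "x \<in> affine hull ?V"
    using x nondeg_simplexD(8)[OF T(1)] hull_inc by metis
  then have "x - vs ! 0 \<in> span {u - vs ! 0 | u. u \<in> ?V - {vs ! 0}}"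
    by (auto simp: affine_hull_span[OF v0])
  moreover have "{u - vs ! 0 | u. u \<in> ?V - {vs ! 0}} \<subseteq> set ?es"
  proof
    fix w assume "w \<in> {u - vs ! 0 | u. u \<in> ?V - {vs ! 0}}"
    then obtain u where u: "w = u - vs ! 0" "u \<in> ?V" "u \<noteq> vs ! 0" by blast
    then obtain i where "i < length vs" "vs ! i = u" "i \<noteq> 0"
      using vs(2) by (metis in_set_conv_nth)
    then show "w \<in> set ?es" unfolding u(1)
      by (cases i) (auto simp: edge_vectors_def)
  qed
  ultimately have "?D (x - vs ! 0) = 0"
    using linear_eq_0_on_span[OF D] D0 by blast
  then have "whitney ?V vs x ?es = whitney ?V vs (vs ! 0) ?es" using split[of x "vs ! 0"] by simp
  also have "\<dots> = 1"
    unfolding whitney_def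
  proof (rule wedge_upper_triangular)
    have c: "coord ?V (vs ! i) (vs ! j) = (if i = j then 1 else 0)"
      if "i < length vs" "j < length vs" for i j
      using coord_vertex[OF V nth nth, of i j] that vs(1) by (auto simp: nth_eq_iff_index_eq)
    \<comment> \<open>The edge \<open>?es ! j\<close> runs from \<open>vs ! 0\<close> to
      \<open>vs ! Suc j\<close>, so the increment is a difference of two vertex values. The
      resulting matrix is the identity except for entries \<open>-1\<close> in row \<open>0\<close>
      to the right of the diagonal.\<close>
    have d: "dcoord ?V (vs ! i) (?es ! j) = (if i = Suc j then 1 else 0) - (if i = 0 then 1 else 0)"
      if "i < length vs" "Suc j < length vs" for i j
    proof -
      have "coord ?V (vs ! i) (vs ! Suc j) = coord ?V (vs ! i) (vs ! 0) + dcoord ?V (vs ! i) (?es ! j)"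
        using coord_add[OF V nth, of i "vs ! 0" "?es ! j"] that es(2) by simp
      then show ?thesis using c[OF that] c[of i 0] that len by auto
    qed
    let ?as = "map (whitney_covector ?V (vs ! 0)) vs" and ?ws = "None # map Some ?es"
    show "length ?ws = length ?as" using es(1) by simp
    have e: "(?as ! i) (?ws ! j) =
        (case j of 0 \<Rightarrow> coord ?V (vs ! i) (vs ! 0) | Suc j \<Rightarrow> dcoord ?V (vs ! i) (?es ! j))"
      if "i < length vs" "j < length vs" for i j
      using that es(1) by (auto simp: whitney_covector_def split: nat.split)
    show "(?as ! i) (?ws ! j) = 0" if "i < length ?as" "j < i" for i j
      using that len e[of i j] c[of i 0] d[of i "j - 1"] by (auto split: nat.splits)
    show "(?as ! i) (?ws ! i) = 1" if "i < length ?as" for i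
      using that len e[of i i] c[of i 0] d[of i "i - 1"] by (auto split: nat.splits)
  qed
  finally show ?thesis .
qed

text \<open>For order \<open>1\<close> the monomial has degree \<open>1 - 1 = 0\<close> and is
  constantly \<open>1\<close>, so only the Whitney forms remain as generators.\<close>

lemma whitney_poly_forms:
  assumes "nondeg_simplex T" "vertex_ordering T (vo T)"
  shows "poly_forms vo (PMinus 1) k T = form.span
    ((\<lambda>\<rho>. tr T (whitney (verts T) (map ((!) (vo T)) \<rho>))) ` incr_tuples (vo T) (k + 1))"
proof -
  have "bary_monomial (vo T) \<alpha> x = 1" if "int (\<Sum>i<length (vo T). \<alpha> i) = 1 - 1" for \<alpha> x
  proof -
    have "(\<Sum>i<length (vo T). \<alpha> i) = 0" using that by linarith
    then show ?thesis by (simp add: bary_monomial_def)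
  qed
  then have eq: "tr T (\<lambda>x ws. bary_monomial (vo T) \<alpha> x * whitney_form (vo T) \<rho> x ws) =
      tr T (whitney (verts T) (map ((!) (vo T)) \<rho>))"
    if "int (\<Sum>i<length (vo T). \<alpha> i) = 1 - 1" "\<rho> \<in> incr_tuples (vo T) (k + 1)" for \<alpha> \<rho>
    using that tr_whitney_form[OF assms] by (simp add: incr_tuples_def)
  obtain \<alpha>\<^sub>0 :: "nat \<Rightarrow> nat" where \<alpha>\<^sub>0: "int (\<Sum>i<length (vo T). \<alpha>\<^sub>0 i) = 1 - 1"
    using that[of "\<lambda>_. 0"] by simp
  have "{tr T (\<lambda>x ws. bary_monomial (vo T) \<alpha> x * whitney_form (vo T) \<rho> x ws) | \<alpha> \<rho>.
      int (\<Sum>i<length (vo T). \<alpha> i) = 1 - 1 \<and> \<rho> \<in> incr_tuples (vo T) (k + 1)} =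
    (\<lambda>\<rho>. tr T (whitney (verts T) (map ((!) (vo T)) \<rho>))) ` incr_tuples (vo T) (k + 1)"
    (is "?L = ?R")
  proof (intro equalityI subsetI)
    fix \<omega> assume "\<omega> \<in> ?L"
    then obtain \<alpha> \<rho> where "int (\<Sum>i<length (vo T). \<alpha> i) = 1 - 1" "\<rho> \<in> incr_tuples (vo T) (k + 1)"
      "\<omega> = tr T (\<lambda>x ws. bary_monomial (vo T) \<alpha> x * whitney_form (vo T) \<rho> x ws)"
      by blast
    then show "\<omega> \<in> ?R" using eq by blast
  next
    fix \<omega> assume "\<omega> \<in> ?R"
    then obtain \<rho> where \<rho>: "\<rho> \<in> incr_tuples (vo T) (k + 1)"
      "\<omega> = tr T (whitney (verts T) (map ((!) (vo T)) \<rho>))"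
      by blast
    then show "\<omega> \<in> ?L" unfolding \<rho>(2) eq[OF \<alpha>\<^sub>0 \<rho>(1), symmetric] using \<alpha>\<^sub>0 by blast
  qed
  then show ?thesis by (simp only: poly_forms.simps)
qed

text \<open>The generators use tuples increasing in the numbering of \<open>T\<close>, whereas
  \<open>us\<close> will be the vertex ordering chosen for a face. Sorting \<open>us\<close> changes
  the form by a sign only.\<close>

lemma whitney_in_poly_forms:
  assumes T: "nondeg_simplex T" "vertex_ordering T (vo T)"
    and us: "distinct us" "set us \<subseteq> verts T" "int (length us) = k + 1"
  shows "tr T (whitney (verts T) us) \<in> poly_forms vo (PMinus 1) k T"
proof -
  let ?vs = "vo T"
  note vs = vertex_orderingD[OF T(2)]
  define I where "I = {i. i < length ?vs \<and> ?vs ! i \<in> set us}"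
  define \<rho> where "\<rho> = sorted_list_of_set I"
  have I: "finite I" "I \<subseteq> {..<length ?vs}" by (auto simp: I_def)
  have inj: "inj_on ((!) ?vs) I"
    using vs(1) by (auto simp: inj_on_def I_def nth_eq_iff_index_eq)
  have "(!) ?vs ` I = set ?vs \<inter> set us"
    unfolding I_def by (auto simp: set_conv_nth[of ?vs])
  then have "(!) ?vs ` I = set us" using us(2) vs(2) by blast
  then have "set (map ((!) ?vs) \<rho>) = set us" "distinct (map ((!) ?vs) \<rho>)"
    using I inj by (auto simp: \<rho>_def distinct_map)
  then have m: "mset (map ((!) ?vs) \<rho>) = mset us"
    using us(1) set_eq_iff_mset_eq_distinct by blast
  then have "length \<rho> = length us" by (metis length_map mset_eq_length)
  then have "\<rho> \<in> incr_tuples ?vs (k + 1)"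
    using us(3) I by (auto simp: incr_tuples_def \<rho>_def)
  then have b: "tr T (whitney (verts T) (map ((!) ?vs) \<rho>)) \<in> poly_forms vo (PMinus 1) k T"
    unfolding whitney_poly_forms[of T vo, OF T] by (intro form.span_base) auto
  obtain s where "whitney (verts T) us = form_scale s (whitney (verts T) (map ((!) ?vs) \<rho>))"
    using whitney_permute[OF m[symmetric]] by metis
  then show ?thesis
    using b unfolding whitney_poly_forms[of T vo, OF T] by (simp add: tr_scale form.span_scale)
qed

lemma tr_sum: "tr T (\<Sum>i\<in>I. \<omega> i) = (\<Sum>i\<in>I. tr T (\<omega> i))"
  by (induction I rule: infinite_finite_induct) (simp_all only: sum.infinite sum.empty sum.insert tr_zero tr_add not_False_eq_True)

text \<open>The integrand is constantly \<open>1\<close> or \<open>-1\<close>, by the relative order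
  of \<open>us\<close> and \<open>vs\<close>, and the standard simplex has volume
  \<open>1 / fact (length vs - 1)\<close>.\<close>

lemma whitney_integral:
  assumes G: "nondeg_simplex G" "vertex_ordering G vs" and us: "distinct us" "set us = verts G"
  shows "simplex_integral vs (tr G (whitney (verts G) us)) \<noteq> 0"
proof -
  have "mset us = mset vs"
    using us vertex_orderingD[OF G(2)] set_eq_iff_mset_eq_distinct by metis
  then obtain s where s: "s = 1 \<or> s = -1" "whitney (verts G) us = form_scale s (whitney (verts G) vs)"
    using whitney_permute by metis
  have "simplex_integral vs (tr G (whitney (verts G) us)) = s / fact (length vs - 1)"
    using s(2) whitney_edge_vectors[OF G] edge_vectors_tangent[OF G]
    by (intro simplex_integral_constant[OF G]) (simp add: tr_def form_scale_def)
  then show ?thesis using s(1) by auto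
qed

lemma whitney_unisolvent:
  assumes T: "nondeg_simplex T" and vo: "\<And>G. G \<in> subsimplices T \<Longrightarrow> vertex_ordering G (vo G)"
    and \<omega>: "\<omega> \<in> poly_forms vo (PMinus 1) k T"
    and int: "\<And>G. G \<in> subsimplices T \<Longrightarrow> aff_dim G = k \<Longrightarrow> simplex_integral (vo G) (tr G \<omega>) = 0"
    and k: "0 \<le> k"
  shows "\<omega> = 0"
proof -
  let ?vs = "vo T" and ?V = "verts T"
  have voT: "vertex_ordering T ?vs"
    using T vo[of T] subsimplices_iff_verts[OF T T] by simp
  note V = nondeg_simplexD(1)[OF T] and vs = vertex_orderingD[OF voT]
  let ?I = "incr_tuples ?vs (k + 1)" and ?us = "map ((!) ?vs)"
  let ?b = "\<lambda>\<rho>. tr T (whitney ?V (?us \<rho>))"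
  have "finite {\<rho>. set \<rho> \<subseteq> {..<length ?vs} \<and> length \<rho> = nat (k + 1)}"
    by (intro finite_lists_length_eq) simp
  then have fin: "finite ?I"
    by (rule rev_finite_subset) (auto simp: incr_tuples_def)
  \<comment> \<open>The coefficients belong to forms and not to tuples; below, a tuple
    \<open>\<rho>\<close> is chosen for each form \<open>a\<close>, and the face spanned by its
    vertices isolates the coefficient of \<open>a\<close>.\<close>
  obtain c where c: "\<omega> = (\<Sum>a\<in>?b ` ?I. form_scale (c a) a)"
    using \<omega> fin unfolding whitney_poly_forms[of T vo, OF T voT] by (auto simp: form.span_finite)
  have "c a = 0" if a: "a \<in> ?b ` ?I" for a
  proof -
    obtain \<rho> where \<rho>: "\<rho> \<in> ?I" "a = ?b \<rho>" using a by blast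
    have inI: "set \<sigma> \<subseteq> {..<length ?vs}" "distinct \<sigma>" "sorted \<sigma>" "int (length \<sigma>) = k + 1"
      if "\<sigma> \<in> ?I" for \<sigma>
      using that by (auto simp: incr_tuples_def strict_sorted_iff)
    have us: "set (?us \<sigma>) \<subseteq> ?V" "distinct (?us \<sigma>)" if "\<sigma> \<in> ?I" for \<sigma>
      using inI[OF that] vs nth_mem
      by (auto simp: distinct_map inj_on_def nth_eq_iff_index_eq subset_iff simp flip: vs(2))
    define G where "G = convex hull set (?us \<rho>)"
    have i: "\<not> affine_dependent (set (?us \<rho>))"
      using us(1)[OF \<rho>(1)] V affine_dependent_subset by blast
    have ne: "set (?us \<rho>) \<noteq> {}" using inI(4)[OF \<rho>(1)] k by auto
    have G: "G \<in> subsimplices T" "verts G = set (?us \<rho>)"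
      unfolding G_def subsimplex_iff[OF T] using verts_convex_hull[OF i] ne us(1)[OF \<rho>(1)] by blast+
    note GT = subsimplexD[OF T G(1)]
    have card: "int (card (set (?us \<rho>))) = k + 1"
      using distinct_card[OF us(2)[OF \<rho>(1)]] inI(4)[OF \<rho>(1)] by simp
    then have dim: "aff_dim G = k"
      using nondeg_simplexD(5)[OF GT(1)] G(2) by simp
    have other: "tr G a' = 0" if a': "a' \<in> ?b ` ?I" "a' \<noteq> a" for a'
    proof -
      obtain \<sigma> where \<sigma>: "\<sigma> \<in> ?I" "a' = ?b \<sigma>" "\<sigma> \<noteq> \<rho>" using a' \<rho>(2) by blast
      have "\<not> set (?us \<sigma>) \<subseteq> set (?us \<rho>)"
      proof
        \<comment> \<open>Both index sets have \<open>k + 1\<close> elements, so inclusion is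
          equality, and an increasing tuple is determined by its set of entries.\<close>
        assume "set (?us \<sigma>) \<subseteq> set (?us \<rho>)"
        then have "set \<sigma> \<subseteq> set \<rho>"
          using inI(1)[OF \<sigma>(1)] inI(1)[OF \<rho>(1)] vs(1)
          by (auto simp: image_subset_iff image_iff nth_eq_iff_index_eq subset_iff)
        then have "set \<sigma> = set \<rho>"
          using inI[OF \<sigma>(1)] inI[OF \<rho>(1)] by (intro card_subset_eq) (auto simp: distinct_card)
        then show False
          using \<sigma>(3) inI[OF \<sigma>(1)] inI[OF \<rho>(1)] sorted_distinct_set_unique by blast
      qed
      then show ?thesis
        unfolding \<sigma>(2) tr_tr[OF GT(3)] tr_whitney_face[OF T G(1) us(1)[OF \<sigma>(1)]] using G(2) by simp
    qed
    have "tr G \<omega> = (\<Sum>a'\<in>?b ` ?I. form_scale (c a') (tr G a'))"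
      unfolding c tr_sum tr_scale ..
    also have "\<dots> = (\<Sum>a'\<in>?b ` ?I. if a' = a then form_scale (c a) (tr G a) else 0)"
      using other by (intro sum.cong) auto
    also have "\<dots> = form_scale (c a) (tr G a)" using fin a by simp
    finally have "simplex_integral (vo G) (tr G \<omega>) = c a * simplex_integral (vo G) (tr G a)"
      by (simp add: simplex_integral_scale)
    moreover have "tr G a = tr G (whitney (verts G) (?us \<rho>))"
      unfolding \<rho>(2) tr_tr[OF GT(3)] tr_whitney_face[OF T G(1) us(1)[OF \<rho>(1)]] using G(2) by simp
    then have "simplex_integral (vo G) (tr G a) \<noteq> 0"
      using whitney_integral[OF GT(1) vo[OF G(1)] us(2)[OF \<rho>(1)]] G(2) by simp
    ultimately show "c a = 0" using int[OF G(1) dim] by simp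
  qed
  then show ?thesis unfolding c by (auto simp: form_scale_def fun_eq_iff sum_fun_apply intro!: sum.neutral)
qed

section \<open>Families of forms\<close>

text \<open>Closure under differences turns injectivity of the summation map into triviality of
  vanishing sums. Passing to arbitrary finite index sets \<open>J\<close> avoids computing exact
  supports.\<close>

lemma is_direct_sum_iff_subgroups:
  fixes S :: "'i \<Rightarrow> 'b::ab_group_add set"
  assumes zero: "\<And>i. i \<in> I \<Longrightarrow> 0 \<in> S i"
    and diff: "\<And>i x y. i \<in> I \<Longrightarrow> x \<in> S i \<Longrightarrow> y \<in> S i \<Longrightarrow> x - y \<in> S i"
    and sub: "\<And>J f. finite J \<Longrightarrow> J \<subseteq> I \<Longrightarrow> (\<And>i. i \<in> J \<Longrightarrow> f i \<in> S i) \<Longrightarrow> sum f J \<in> X"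
    and ex: "\<And>x. x \<in> X \<Longrightarrow> \<exists>J f. finite J \<and> J \<subseteq> I \<and> (\<forall>i\<in>J. f i \<in> S i) \<and> x = sum f J"
    and uniq: "\<And>J f i. finite J \<Longrightarrow> J \<subseteq> I \<Longrightarrow> (\<And>i. i \<in> J \<Longrightarrow> f i \<in> S i) \<Longrightarrow> sum f J = 0 \<Longrightarrow>
      i \<in> J \<Longrightarrow> f i = 0"
  shows "is_direct_sum X I S"
  unfolding is_direct_sum_def bij_betw_def
proof
  have supp: "(\<Sum>i | f i \<noteq> 0. f i) = sum f J" if "finite J" "{i. f i \<noteq> 0} \<subseteq> J" for f :: "'i \<Rightarrow> 'b" and J
    using that by (intro sum.mono_neutral_left) auto
  show "inj_on (\<lambda>f. \<Sum>i | f i \<noteq> 0. f i) (external_sum I S)"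
  proof (rule inj_onI)
    fix f g assume f: "f \<in> external_sum I S" and g: "g \<in> external_sum I S"
      and eq: "(\<Sum>i | f i \<noteq> 0. f i) = (\<Sum>i | g i \<noteq> 0. g i)"
    define J where "J = {i. f i \<noteq> 0} \<union> {i. g i \<noteq> 0}"
    have J: "finite J" "J \<subseteq> I" using f g by (auto simp: J_def external_sum_def)
    have "sum f J = sum g J"
      using eq supp[of J f] supp[of J g] J by (auto simp: J_def)
    then have "(\<Sum>i\<in>J. f i - g i) = 0" by (simp add: sum_subtractf)
    moreover have "f i - g i \<in> S i" if "i \<in> J" for i
      using that J(2) f g by (auto simp: external_sum_def intro!: diff)
    ultimately have "f i - g i = 0" if "i \<in> J" for i
      using uniq[of J "\<lambda>i. f i - g i"] J that by blast
    moreover have "f i = g i" if "i \<notin> J" for i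
      using that by (simp add: J_def)
    ultimately show "f = g" by (metis eq_iff_diff_eq_0 ext)
  qed
  show "(\<lambda>f. \<Sum>i | f i \<noteq> 0. f i) ` external_sum I S = X"
  proof (intro equalityI subsetI)
    fix x assume "x \<in> (\<lambda>f. \<Sum>i | f i \<noteq> 0. f i) ` external_sum I S"
    then obtain f where f: "f \<in> external_sum I S" "x = (\<Sum>i | f i \<noteq> 0. f i)" by blast
    then have "finite {i. f i \<noteq> 0}" "{i. f i \<noteq> 0} \<subseteq> I" "\<forall>i\<in>I. f i \<in> S i"
      by (auto simp: external_sum_def)
    then show "x \<in> X" unfolding f(2) by (intro sub) auto
  next
    fix x assume "x \<in> X"
    then obtain J f where J: "finite J" "J \<subseteq> I" "\<forall>i\<in>J. f i \<in> S i" "x = sum f J" using ex by blast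
    let ?f = "\<lambda>i. if i \<in> J then f i else 0"
    have "finite {i. ?f i \<noteq> 0}" by (rule finite_subset[OF _ J(1)]) auto
    then have "?f \<in> external_sum I S"
      using J zero by (auto simp: external_sum_def)
    moreover have "(\<Sum>i | ?f i \<noteq> 0. ?f i) = sum ?f J"
      by (rule supp[OF J(1)]) auto
    then have "x = (\<Sum>i | ?f i \<noteq> 0. ?f i)"
      unfolding J(4) by (simp cong: sum.cong)
    ultimately show "x \<in> (\<lambda>f. \<Sum>i | f i \<noteq> 0. f i) ` external_sum I S" by blast
  qed
qed

lemma subspace_poly_forms: "form.subspace (poly_forms vo p k T)"
  by (cases p) auto

lemma family_diff_apply: "(\<omega> - \<eta>) T = \<omega> T - (\<eta> T :: 'a form)" for \<omega> \<eta> :: "'a form_family"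
  by simp

lemma family_zero_apply: "(0 :: 'a form_family) T = 0"
  by simp

lemma smooth_families_zero: "0 \<in> smooth_families k \<T> \<U>"
  using form.subspace_0[OF subspace_smooth_forms[of k]] by (auto simp: smooth_families_def tr_zero[unfolded zero_fun_def] zero_fun_def)

lemma smooth_families_diff:
  assumes "\<omega> \<in> smooth_families k \<T> \<U>" "\<eta> \<in> smooth_families k \<T> \<U>"
  shows "\<omega> - \<eta> \<in> smooth_families k \<T> \<U>"
proof -
  have "finite {T. (\<omega> - \<eta>) T \<noteq> 0}"
    by (rule finite_subset[of _ "{T. \<omega> T \<noteq> 0} \<union> {T. \<eta> T \<noteq> 0}"])
      (use assms in \<open>auto simp: smooth_families_def\<close>)
  moreover have "\<forall>T\<in>\<T>. (\<omega> - \<eta>) T \<in> smooth_forms k T"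
    unfolding family_diff_apply
    using assms by (auto simp: smooth_families_def intro!: form.subspace_diff[OF subspace_smooth_forms])
  moreover have "\<forall>T\<in>\<T>. \<forall>F\<in>subsimplices T. tr F ((\<omega> - \<eta>) T) = (\<omega> - \<eta>) F"
    unfolding family_diff_apply tr_diff using assms by (simp add: smooth_families_def)
  ultimately show ?thesis
    using assms unfolding smooth_families_def mem_Collect_eq family_diff_apply by simp
qed

lemma poly_families_zero: "0 \<in> poly_families vo P k \<T> \<U>"
  unfolding poly_families_def mem_Collect_eq
  by (simp only: smooth_families_zero family_zero_apply form.subspace_0[OF subspace_poly_forms] simp_thms ball_triv)

lemma poly_families_diff:
  assumes "\<omega> \<in> poly_families vo P k \<T> \<U>" "\<eta> \<in> poly_families vo P k \<T> \<U>"
  shows "\<omega> - \<eta> \<in> poly_families vo P k \<T> \<U>"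
  using assms smooth_families_diff[of \<omega> k \<T> \<U> \<eta>]
  unfolding poly_families_def mem_Collect_eq family_diff_apply
  by (simp add: form.subspace_diff[OF subspace_poly_forms])

lemma poly_families_sum:
  assumes "\<And>i. i \<in> I \<Longrightarrow> \<omega> i \<in> poly_families vo P k \<T> \<U>"
  shows "sum \<omega> I \<in> poly_families vo P k \<T> \<U>"
  using assms
proof (induction I rule: infinite_finite_induct)
  case (insert i I)
  have "\<omega> i - (0 - sum \<omega> I) \<in> poly_families vo P k \<T> \<U>"
    using insert by (intro poly_families_diff poly_families_zero) auto
  then show ?case using insert.hyps by (simp only: sum.insert diff_0 diff_minus_eq_add not_False_eq_True)
qed (simp_all only: sum.infinite sum.empty poly_families_zero not_False_eq_True)

text \<open>Treating Whitney forms as a constant type lets the closure properties of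
  \<open>poly_families\<close> apply to both sides of the decomposition.\<close>

lemma whitney_families_eq: "whitney_families vo k \<T> \<U> = poly_families vo (\<lambda>_ _. PMinus 1) k \<T> \<U>"
  by (simp add: whitney_families_def poly_families_def)

lemma simplex_integral_zero: "simplex_integral vs 0 = 0"
  by (simp add: simplex_integral_eq)

lemma form_diff_eq: "\<omega> - \<eta> = \<omega> + form_scale (-1) \<eta>"
  by (auto simp: form_scale_def fun_eq_iff)

lemma simplex_integral_diff:
  assumes "nondeg_simplex T" "vertex_ordering T vs" "\<omega> \<in> smooth_forms k T" "\<eta> \<in> smooth_forms k T"
  shows "simplex_integral vs (\<omega> - \<eta>) = simplex_integral vs \<omega> - simplex_integral vs \<eta>"
  unfolding form_diff_eq using assms
  by (simp only: simplex_integral_add[OF assms(1,2,3)] form.subspace_scale[OF subspace_smooth_forms]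
        simplex_integral_scale)

lemma subspace_bubble0_forms:
  assumes T: "nondeg_simplex T" "vertex_ordering T (vo T)"
  shows "form.subspace (bubble0_forms vo p k T)"
proof (rule form.subspaceI)
  note S = subspace_poly_forms[of vo p k T]
  have smooth: "\<omega> \<in> smooth_forms k T" if "\<omega> \<in> poly_forms vo p k T" for \<omega>
    using poly_forms_subset_smooth_forms[of T vo, OF T] that by blast
  show "0 \<in> bubble0_forms vo p k T"
    using form.subspace_0[OF S] by (simp only: bubble0_forms_def bubble_forms_def mem_Collect_eq
        tr_zero simplex_integral_zero) blast
  show "\<omega> + \<eta> \<in> bubble0_forms vo p k T"
    if "\<omega> \<in> bubble0_forms vo p k T" "\<eta> \<in> bubble0_forms vo p k T" for \<omega> \<eta>
    using that form.subspace_add[OF S] simplex_integral_add[OF T smooth smooth, of \<omega> \<eta>]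
    by (simp only: bubble0_forms_def bubble_forms_def mem_Collect_eq tr_add) simp
  show "form_scale c \<omega> \<in> bubble0_forms vo p k T" if "\<omega> \<in> bubble0_forms vo p k T" for c \<omega>
    using that form.subspace_scale[OF S] form.scale_zero_right
    by (simp only: bubble0_forms_def bubble_forms_def mem_Collect_eq tr_scale simplex_integral_scale) simp
qed

section \<open>Whitney families on a complex and their degrees of freedom\<close>

context
  fixes \<T> :: "'a::euclidean_space set set"
    and vo :: "'a set \<Rightarrow> 'a list"
  assumes complex: "simplex_complex \<T>"
    and orientation: "\<forall>T\<in>\<T>. vertex_ordering T (vo T)"
begin

lemma complexD:
  assumes "T \<in> \<T>"
  shows "nondeg_simplex T" "vertex_ordering T (vo T)" "\<And>F. F \<in> subsimplices T \<Longrightarrow> F \<in> \<T>"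
    "T \<in> subsimplices T"
proof -
  show T: "nondeg_simplex T" and "vertex_ordering T (vo T)" "\<And>F. F \<in> subsimplices T \<Longrightarrow> F \<in> \<T>"
    using assms complex orientation by (auto simp: simplex_complex_def)
  show "T \<in> subsimplices T" using subsimplices_iff_verts[OF T T] by simp
qed

text \<open>Traces of a component are the components on its faces, so the local statement applies on
  each simplex. Negative \<open>k\<close> is separate: there every form is zero.\<close>

lemma whitney_family_unisolvent:
  assumes w: "w \<in> whitney_families vo k \<T> \<U>"
    and int: "\<And>G. G \<in> \<T> \<Longrightarrow> aff_dim G = k \<Longrightarrow> simplex_integral (vo G) (w G) = 0"
  shows "w = 0"
proof -
  have "w T = 0" for T
  proof (cases "T \<in> \<T>")
    case True
    note T = complexD[OF True]
    have wT: "w T \<in> poly_forms vo (PMinus 1) k T" "w T \<in> smooth_forms k T"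
      "\<And>G. G \<in> subsimplices T \<Longrightarrow> tr G (w T) = w G"
      using w True by (auto simp: whitney_families_def smooth_families_def)
    show ?thesis
    proof (cases "k < 0")
      case True
      then show ?thesis using smooth_forms_eq_0[OF T(1) wT(2)] by blast
    next
      case False
      show ?thesis
      proof (rule whitney_unisolvent[OF T(1) _ wT(1)])
        fix G assume G: "G \<in> subsimplices T"
        show "vertex_ordering G (vo G)" using complexD(2) T(3)[OF G] by blast
        show "simplex_integral (vo G) (tr G (w T)) = 0" if "aff_dim G = k"
          unfolding wT(3)[OF G] using int[OF T(3)[OF G] that] .
      qed (use False in simp)
    qed
  next
    case False
    then show ?thesis using w by (simp add: whitney_families_def smooth_families_def)
  qed
  then show ?thesis by (simp add: fun_eq_iff)
qed

text \<open>For \<open>k\<close>-dimensional \<open>F\<close>, this is up to scaling the basis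
  element dual to integration over \<open>F\<close>. The vertex list \<open>vo F\<close> is used on
  every \<open>T\<close>, so that the pieces have matching traces with no sign depending on
  \<open>vo T\<close>.\<close>

definition whitney_family :: "'a set \<Rightarrow> real \<Rightarrow> 'a form_family" where
  "whitney_family F c = (\<lambda>T. if T \<in> \<T> \<and> F \<in> subsimplices T
     then form_scale c (tr T (whitney (verts T) (vo F))) else 0)"

lemma whitney_family_mem:
  assumes \<U>: "simplex_complex \<U>" and F: "F \<in> \<T> - \<U>" "aff_dim F = k"
    and fin: "finite {T \<in> \<T>. F \<in> subsimplices T}"
  shows "whitney_family F c \<in> whitney_families vo k \<T> \<U>"
proof -
  note FD = complexD[of F]
  have F\<T>: "F \<in> \<T>" using F by blast
  note vs = vertex_orderingD[OF FD(2)[OF F\<T>]]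
  let ?w = "whitney_family F c"
  have poly: "?w T \<in> poly_forms vo (PMinus 1) k T" if T: "T \<in> \<T>" for T
  proof (cases "F \<in> subsimplices T")
    case True
    have "set (vo F) \<subseteq> verts T"
      using subsimplexD(2)[OF complexD(1)[OF T] True] vs(2) by simp
    then have "tr T (whitney (verts T) (vo F)) \<in> poly_forms vo (PMinus 1) k T"
      using length_vertex_ordering[OF FD(1)[OF F\<T>] FD(2)[OF F\<T>]] F(2) vs
      by (intro whitney_in_poly_forms complexD[OF T]) auto
    then show ?thesis
      using True T by (simp only: whitney_family_def simp_thms if_True
          form.subspace_scale[OF subspace_poly_forms])
  next
    case False
    then show ?thesis
      by (simp only: whitney_family_def simp_thms if_False form.subspace_0[OF subspace_poly_forms])
  qed
  then have "\<forall>T\<in>\<T>. ?w T \<in> smooth_forms k T"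
    using poly_forms_subset_smooth_forms complexD by blast
  moreover have "finite {T. ?w T \<noteq> 0}"
    by (rule finite_subset[OF _ fin]) (auto simp: whitney_family_def)
  moreover have "tr G (?w T) = ?w G" if T: "T \<in> \<T>" and G: "G \<in> subsimplices T" for T G
  proof -
    note TD = complexD[OF T] and GT = subsimplexD[OF complexD(1)[OF T] G]
    have FG: "F \<in> subsimplices G \<longleftrightarrow> set (vo F) \<subseteq> verts G"
      using subsimplices_iff_verts[OF GT(1) FD(1)[OF F\<T>]] vs(2) by simp
    have FT: "F \<in> subsimplices T \<longleftrightarrow> set (vo F) \<subseteq> verts T"
      using subsimplices_iff_verts[OF TD(1) FD(1)[OF F\<T>]] vs(2) by simp
    show ?thesis
    proof (cases "F \<in> subsimplices T")
      case True
      then have "tr G (?w T) = form_scale c (tr G (whitney (verts T) (vo F)))"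
        using T by (simp only: whitney_family_def simp_thms if_True tr_scale tr_tr[OF GT(3)])
      also have "\<dots> = ?w G"
        using True FT FG TD(3)[OF G] form.scale_zero_right
        by (simp only: tr_whitney_face[OF TD(1) G] whitney_family_def) simp
      finally show ?thesis .
    next
      case False
      then have "F \<notin> subsimplices G" using FT FG GT(2) by blast
      with False show ?thesis by (simp only: whitney_family_def simp_thms if_False tr_zero)
    qed
  qed
  \<comment> \<open>\<open>\<U>\<close> is closed under faces, so none of its members contains
    \<open>F\<close>.\<close>
  moreover have "?w T = 0" if "T \<in> \<U>" for T
    using that \<U> F by (auto simp: whitney_family_def simplex_complex_def)
  ultimately show ?thesis
    using poly unfolding whitney_families_def smooth_families_def
    by (simp add: whitney_family_def)
qed

lemma whitney_interpolation:
  assumes \<U>: "simplex_complex \<U>" and \<omega>: "\<omega> \<in> smooth_families k \<T> \<U>"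
  obtains w where "w \<in> whitney_families vo k \<T> \<U>"
    "\<And>G. G \<in> \<T> \<Longrightarrow> aff_dim G = k \<Longrightarrow> simplex_integral (vo G) (w G) = simplex_integral (vo G) (\<omega> G)"
proof -
  define N where "N = {F \<in> \<T>. aff_dim F = k \<and> \<omega> F \<noteq> 0}"
  define d where "d F = simplex_integral (vo F) (tr F (whitney (verts F) (vo F)))" for F
  \<comment> \<open>On a \<open>k\<close>-simplex only its own Whitney family is nonzero, so the
    linear system for the coefficients is diagonal with entries \<open>d F\<close>.\<close>
  define c where "c F = simplex_integral (vo F) (\<omega> F) / d F" for F
  have supp: "finite {T. \<omega> T \<noteq> 0}" using \<omega> by (simp add: smooth_families_def)
  then have N: "finite N" by (rule rev_finite_subset) (auto simp: N_def)
  have "whitney_family F (c F) \<in> whitney_families vo k \<T> \<U>" if F: "F \<in> N" for F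
  proof (rule whitney_family_mem[OF \<U>])
    show "F \<in> \<T> - \<U>" "aff_dim F = k" using F \<omega> by (auto simp: N_def smooth_families_def)
    have "\<omega> T \<noteq> 0" if "T \<in> \<T>" "F \<in> subsimplices T" for T
    proof
      assume "\<omega> T = 0"
      moreover have "tr F (\<omega> T) = \<omega> F" using that \<omega> by (simp add: smooth_families_def)
      ultimately show False using F unfolding N_def mem_Collect_eq by (metis tr_zero)
    qed
    then show "finite {T \<in> \<T>. F \<in> subsimplices T}"
      by (intro finite_subset[OF _ supp]) auto
  qed
  then have "(\<Sum>F\<in>N. whitney_family F (c F)) \<in> whitney_families vo k \<T> \<U>"
    unfolding whitney_families_eq by (rule poly_families_sum)
  moreover have "simplex_integral (vo G) ((\<Sum>F\<in>N. whitney_family F (c F)) G) = simplex_integral (vo G) (\<omega> G)"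
    if G: "G \<in> \<T>" "aff_dim G = k" for G
  proof -
    note GD = complexD[OF G(1)] and vs = vertex_orderingD[OF complexD(2)[OF G(1)]]
    \<comment> \<open>A proper face of \<open>G\<close> has dimension below \<open>k\<close>, hence
      is not in \<open>N\<close>.\<close>
    have *: "whitney_family F (c F) G =
        (if F = G then form_scale (c G) (tr G (whitney (verts G) (vo G))) else 0)" if "F \<in> N" for F
      using that G GD subsimplexD(5)[OF GD(1), of F] by (auto simp: whitney_family_def N_def)
    then have "(\<Sum>F\<in>N. whitney_family F (c F)) G =
        (\<Sum>F\<in>N. if F = G then form_scale (c G) (tr G (whitney (verts G) (vo G))) else 0)"
      by (subst sum_fun_apply) (rule sum.cong[OF refl *])
    also have "\<dots> = (if G \<in> N then form_scale (c G) (tr G (whitney (verts G) (vo G))) else 0)"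
      by (rule sum.delta[OF N])
    finally have eq: "(\<Sum>F\<in>N. whitney_family F (c F)) G = \<dots>" .
    have "d G \<noteq> 0" unfolding d_def using vs by (intro whitney_integral GD) auto
    then show ?thesis
      unfolding eq using G simplex_integral_zero
      by (cases "G \<in> N") (simp_all add: simplex_integral_scale c_def d_def[symmetric] N_def)
  qed
  ultimately show thesis using that by blast
qed

end

section \<open>The bubble decomposition\<close>

context
  fixes \<T> :: "'a::euclidean_space set set"
    and vo :: "'a set \<Rightarrow> 'a list"
    and P :: "'a set \<Rightarrow> int \<Rightarrow> ptype"
    and ext :: "int \<Rightarrow> 'a set \<Rightarrow> 'a set \<Rightarrow> 'a form \<Rightarrow> 'a form"
    and k :: int
  assumes complex: "simplex_complex \<T>"
    and orientation: "\<forall>T\<in>\<T>. vertex_ordering T (vo T)"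
    and extension: "extension_operators vo P \<T> ext"
    and Ext_finite: "\<forall>F\<in>\<T>. \<forall>\<eta>\<in>bubble0_forms vo (P F k) k F. finite {T. Ext ext \<T> k F \<eta> T \<noteq> 0}"
begin

abbreviation (input) bubbles :: "'a set \<Rightarrow> 'a form set" where
  "bubbles F \<equiv> bubble0_forms vo (P F k) k F"

lemmas \<T>D = complexD[OF complex orientation]

lemma subspace_bubbles: "F \<in> \<T> \<Longrightarrow> form.subspace (bubbles F)"
  using subspace_bubble0_forms \<T>D by blast

lemma bubbles_smooth: "F \<in> \<T> \<Longrightarrow> \<eta> \<in> bubbles F \<Longrightarrow> \<eta> \<in> smooth_forms k F"
  using poly_forms_subset_smooth_forms[of F vo] \<T>D(1,2)[of F]
  by (auto simp: bubble0_forms_def bubble_forms_def)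

lemma extensionD:
  assumes "T \<in> \<T>" "F \<in> subsimplices T" "\<eta> \<in> bubbles F"
  shows "ext k F T \<eta> \<in> poly_forms vo (P T k) k T"
    and "\<And>\<theta>. \<theta> \<in> bubbles F \<Longrightarrow> ext k F T (\<eta> + \<theta>) = ext k F T \<eta> + ext k F T \<theta>"
    and "\<And>c. ext k F T (form_scale c \<eta>) = form_scale c (ext k F T \<eta>)"
    and "\<And>G. G \<in> subsimplices T \<Longrightarrow> F \<in> subsimplices G \<Longrightarrow> tr G (ext k F T \<eta>) = ext k F G \<eta>"
    and "\<And>G. G \<in> subsimplices T \<Longrightarrow> F \<notin> subsimplices G \<Longrightarrow> tr G (ext k F T \<eta>) = 0"
proof -
  note e = extension[unfolded extension_operators_def Let_def]
  show "ext k F T \<eta> \<in> poly_forms vo (P T k) k T"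
    using e[THEN conjunct1] assms by blast
  note e = e[THEN conjunct2]
  show "ext k F T (\<eta> + \<theta>) = ext k F T \<eta> + ext k F T \<theta>" if "\<theta> \<in> bubbles F" for \<theta>
    using e[THEN conjunct1] assms that by blast
  note e = e[THEN conjunct2]
  show "ext k F T (form_scale c \<eta>) = form_scale c (ext k F T \<eta>)" for c
    using e[THEN conjunct1] assms by blast
  note e = e[THEN conjunct2, THEN conjunct2]
  show "tr G (ext k F T \<eta>) = ext k F G \<eta>" if "G \<in> subsimplices T" "F \<in> subsimplices G" for G
    using e[THEN conjunct1] assms that by blast
  note e = e[THEN conjunct2]
  show "tr G (ext k F T \<eta>) = 0" if "G \<in> subsimplices T" "F \<notin> subsimplices G" for G
    using e assms that by blast
qed

lemma ext_self: "F \<in> \<T> \<Longrightarrow> \<eta> \<in> bubbles F \<Longrightarrow> ext k F F \<eta> = \<eta>"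
  using extension[unfolded extension_operators_def Let_def,
    THEN conjunct2, THEN conjunct2, THEN conjunct2, THEN conjunct1] by blast

lemma ext_zero: "T \<in> \<T> \<Longrightarrow> F \<in> subsimplices T \<Longrightarrow> ext k F T 0 = 0"
  using extensionD(3)[of T F 0 0] form.subspace_0[OF subspace_bubbles] \<T>D(3)
  by (metis form.scale_zero_left)

lemma Ext_diff:
  assumes "F \<in> \<T>" "\<eta> \<in> bubbles F" "\<theta> \<in> bubbles F"
  shows "Ext ext \<T> k F (\<eta> - \<theta>) = Ext ext \<T> k F \<eta> - Ext ext \<T> k F \<theta>"
proof (rule HOL.ext)
  fix T
  show "Ext ext \<T> k F (\<eta> - \<theta>) T = (Ext ext \<T> k F \<eta> - Ext ext \<T> k F \<theta>) T"
  proof (cases "T \<in> \<T> \<and> F \<in> subsimplices T")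
    case True
    have "form_scale (-1) \<theta> \<in> bubbles F"
      using form.subspace_scale[OF subspace_bubbles] assms by blast
    then have "ext k F T (\<eta> - \<theta>) = ext k F T \<eta> - ext k F T \<theta>"
      using True extensionD(2)[of T F \<eta>] extensionD(3)[of T F \<theta>] assms
      unfolding form_diff_eq by metis
    then show ?thesis unfolding family_diff_apply using True by (simp only: Ext_def simp_thms if_True)
  next
    case False
    then show ?thesis unfolding family_diff_apply by (simp only: Ext_def if_False diff_self)
  qed
qed

text \<open>For a face \<open>G\<close> of \<open>T\<close> containing \<open>F\<close>, trace
  compatibility is the second axiom on traces of extensions being applied along \<open>F\<close>,
  \<open>G\<close>, \<open>T\<close>; if \<open>G\<close> does not contain \<open>F\<close>, both
  sides are zero.\<close>

lemma Ext_mem_poly_families: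
  assumes \<U>: "simplex_complex \<U>" and F: "F \<in> \<T> - \<U>" and \<eta>: "\<eta> \<in> bubbles F"
  shows "Ext ext \<T> k F \<eta> \<in> poly_families vo P k \<T> \<U>"
proof -
  let ?E = "Ext ext \<T> k F \<eta>"
  have trans: "F \<in> subsimplices T" if "T \<in> \<T>" "G \<in> subsimplices T" "F \<in> subsimplices G" for T G
    using that face_of_trans unfolding subsimplices_def by blast
  have poly: "\<forall>T\<in>\<T>. ?E T \<in> poly_forms vo (P T k) k T"
    using extensionD(1)[OF _ _ \<eta>] form.subspace_0[OF subspace_poly_forms]
    unfolding Ext_def by metis
  then have "\<forall>T\<in>\<T>. ?E T \<in> smooth_forms k T"
    using poly_forms_subset_smooth_forms \<T>D(1,2) by blast
  moreover have "\<forall>T\<in>\<T>. \<forall>G\<in>subsimplices T. tr G (?E T) = ?E G"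
  proof (intro ballI)
    fix T G assume T: "T \<in> \<T>" and G: "G \<in> subsimplices T"
    show "tr G (?E T) = ?E G"
      using extensionD(4,5)[OF T _ \<eta> G] trans[OF T G] \<T>D(3)[OF T G] tr_zero[of G] T
      unfolding Ext_def by (smt (verit))
  qed
  moreover have "finite {T. ?E T \<noteq> 0}" using Ext_finite F \<eta> by blast
  moreover have "\<forall>T\<in>\<U>. ?E T = 0"
    using \<U> F unfolding Ext_def simplex_complex_def by auto
  moreover have "\<forall>T. T \<notin> \<T> \<longrightarrow> ?E T = 0" unfolding Ext_def by auto
  ultimately show ?thesis
    using poly unfolding poly_families_def smooth_families_def by blast
qed

text \<open>On \<open>G\<close> a term is zero unless \<open>F\<close> is a face of
  \<open>G\<close>; proper faces are removed by \<open>lower\<close>, and \<open>F = G\<close>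
  returns the bubble itself. Both existence and uniqueness use this to read off bubbles dimension by
  dimension.\<close>

lemma sum_Ext_apply:
  assumes G: "G \<in> \<T>" and A: "finite A" "\<And>F. F \<in> A \<Longrightarrow> F \<in> \<T> \<and> \<eta> F \<in> bubbles F"
    and lower: "\<And>F. F \<in> A \<Longrightarrow> F \<in> subsimplices G \<Longrightarrow> F \<noteq> G \<Longrightarrow> \<eta> F = 0"
  shows "(\<Sum>F\<in>A. Ext ext \<T> k F (\<eta> F)) G = (if G \<in> A then \<eta> G else 0)"
proof -
  have *: "Ext ext \<T> k F (\<eta> F) G = (if F = G then \<eta> G else 0)" if F: "F \<in> A" for F
  proof (cases "F \<in> subsimplices G")
    case True
    then show ?thesis
      using G ext_self[of F "\<eta> F"] A(2)[OF F] lower[OF F True] ext_zero[OF G True]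
      unfolding Ext_def by auto
  next
    case False
    then show ?thesis using \<T>D(4)[OF G] unfolding Ext_def by auto
  qed
  then have "(\<Sum>F\<in>A. Ext ext \<T> k F (\<eta> F)) G = (\<Sum>F\<in>A. if F = G then \<eta> G else 0)"
    by (subst sum_fun_apply) (rule sum.cong[OF refl *])
  also have "\<dots> = (if G \<in> A then \<eta> G else 0)" using A(1) by (rule sum.delta)
  finally show ?thesis .
qed

lemma bubble_decomposition:
  assumes \<U>: "simplex_complex \<U>" and m: "k \<le> m"
    and \<omega>: "\<omega> \<in> poly_families vo P k \<T> \<U>"
    and int: "\<And>F. F \<in> \<T> \<Longrightarrow> aff_dim F = k \<Longrightarrow> simplex_integral (vo F) (\<omega> F) = 0"
    and low: "\<And>F. F \<in> \<T> \<Longrightarrow> aff_dim F < m \<Longrightarrow> \<omega> F = 0"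
  shows "\<exists>A \<eta>. finite A \<and> A \<subseteq> \<T> - \<U> \<and> (\<forall>F\<in>A. m \<le> aff_dim F \<and> \<eta> F \<in> bubbles F) \<and>
    \<omega> = (\<Sum>F\<in>A. Ext ext \<T> k F (\<eta> F))"
  using m \<omega> int low
\<comment> \<open>The induction moves upwards in \<open>m\<close> and ends when \<open>m\<close>
  exceeds the ambient dimension, where no simplices are left.\<close>
proof (induction "nat (int DIM('a) + 1 - m)" arbitrary: m \<omega>)
  case 0
  have "\<omega> F = 0" for F
  proof (cases "F \<in> \<T>")
    case True
    have "aff_dim F < m" using 0(1) aff_dim_le_DIM[of F] by linarith
    then show ?thesis using 0(5)[OF True] by blast
  next
    case False
    then show ?thesis using 0(3) unfolding poly_families_def smooth_families_def by blast
  qed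
  then have "\<omega> = 0" by (simp add: fun_eq_iff)
  then show ?case by (intro exI[of _ "{}"]) auto
next
  case (Suc n)
  note \<omega> = Suc.prems(2)
  have \<omega>D: "finite {T. \<omega> T \<noteq> 0}" "\<And>T. T \<in> \<T> \<Longrightarrow> \<omega> T \<in> poly_forms vo (P T k) k T"
    "\<And>T F. T \<in> \<T> \<Longrightarrow> F \<in> subsimplices T \<Longrightarrow> tr F (\<omega> T) = \<omega> F" "\<And>T. T \<in> \<U> \<Longrightarrow> \<omega> T = 0"
    using \<omega> unfolding poly_families_def smooth_families_def by blast+
  define N where "N = {F \<in> \<T>. aff_dim F = m \<and> \<omega> F \<noteq> 0}"
  have N: "finite N" by (rule finite_subset[OF _ \<omega>D(1)]) (auto simp: N_def)
  have N\<U>: "N \<subseteq> \<T> - \<U>" using \<omega>D(4) unfolding N_def by blast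
  \<comment> \<open>Traces on proper faces vanish by \<open>low\<close>. The integral condition
    concerns only \<open>m = k\<close>, where it is the hypothesis \<open>int\<close>.\<close>
  have bub: "\<omega> F \<in> bubbles F" if F: "F \<in> N" for F
  proof -
    have F\<T>: "F \<in> \<T>" and dim: "aff_dim F = m" using F by (auto simp: N_def)
    have "tr G (\<omega> F) = 0" if G: "G \<in> subsimplices F" "G \<noteq> F" for G
      using \<omega>D(3)[OF F\<T> G(1)] Suc.prems(4)[OF \<T>D(3)[OF F\<T> G(1)]]
        subsimplexD(5)[OF \<T>D(1)[OF F\<T>] G] dim by simp
    then show ?thesis
      using \<omega>D(2)[OF F\<T>] Suc.prems(3)[OF F\<T>] unfolding bubble0_forms_def bubble_forms_def by simp
  qed
  let ?\<sigma> = "\<Sum>F\<in>N. Ext ext \<T> k F (\<omega> F)"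
  have \<sigma>: "?\<sigma> G = (if G \<in> N then \<omega> G else 0)" if G: "G \<in> \<T>" "aff_dim G \<le> m" for G
  proof (rule sum_Ext_apply[OF G(1) N])
    show "F \<in> \<T> \<and> \<omega> F \<in> bubbles F" if "F \<in> N" for F
      using bub[OF that] N\<U> that by blast
    show "\<omega> F = 0" if "F \<in> N" "F \<in> subsimplices G" "F \<noteq> G" for F
      using subsimplexD(5)[OF \<T>D(1)[OF G(1)] that(2,3)] that(1) G(2) by (simp add: N_def)
  qed
  have "?\<sigma> \<in> poly_families vo P k \<T> \<U>"
    using bub N\<U> by (intro poly_families_sum Ext_mem_poly_families[OF \<U>]) blast+
  then have mem: "\<omega> - ?\<sigma> \<in> poly_families vo P k \<T> \<U>" by (rule poly_families_diff[OF \<omega>])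
  have low': "(\<omega> - ?\<sigma>) G = 0" if "G \<in> \<T>" "aff_dim G \<le> m" for G
    unfolding family_diff_apply \<sigma>[OF that] using Suc.prems(4)[OF that(1)] that
    by (cases "aff_dim G = m") (auto simp: N_def)
  have "\<exists>A \<eta>. finite A \<and> A \<subseteq> \<T> - \<U> \<and> (\<forall>F\<in>A. m + 1 \<le> aff_dim F \<and> \<eta> F \<in> bubbles F) \<and>
      \<omega> - ?\<sigma> = (\<Sum>F\<in>A. Ext ext \<T> k F (\<eta> F))"
  proof (rule Suc.hyps(1))
    show "n = nat (int DIM('a) + 1 - (m + 1))" using Suc.hyps(2) by linarith
    show "k \<le> m + 1" using Suc.prems(1) by simp
    \<comment> \<open>Since \<open>k \<le> m\<close>, the remainder already vanishes on
      \<open>k\<close>-simplices.\<close>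
    show "simplex_integral (vo F) ((\<omega> - ?\<sigma>) F) = 0" if "F \<in> \<T>" "aff_dim F = k" for F
      using low'[OF that(1)] that(2) Suc.prems(1) simplex_integral_zero by metis
    show "(\<omega> - ?\<sigma>) F = 0" if "F \<in> \<T>" "aff_dim F < m + 1" for F
      using low' that by force
  qed (fact mem)
  then obtain A \<eta> where A: "finite A" "A \<subseteq> \<T> - \<U>" "\<And>F. F \<in> A \<Longrightarrow> m + 1 \<le> aff_dim F \<and> \<eta> F \<in> bubbles F"
    "\<omega> - ?\<sigma> = (\<Sum>F\<in>A. Ext ext \<T> k F (\<eta> F))" by blast
  let ?\<theta> = "\<lambda>F. if F \<in> N then \<omega> F else \<eta> F"
  \<comment> \<open>The lower bound on \<open>aff_dim F\<close> is carried through the induction for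
    this: each simplex receives its bubble at exactly one stage, so the choices combine into one
    function \<open>?\<theta>\<close>.\<close>
  have disj: "N \<inter> A = {}" using A(3) unfolding N_def by force
  have "\<omega> = ?\<sigma> + (\<Sum>F\<in>A. Ext ext \<T> k F (\<eta> F))" unfolding A(4)[symmetric] by (simp only: add_diff_eq add_diff_cancel_left')
  also have "\<dots> = (\<Sum>F\<in>N. Ext ext \<T> k F (?\<theta> F)) + (\<Sum>F\<in>A. Ext ext \<T> k F (?\<theta> F))"
    using disj by (intro arg_cong2[where f = "(+)"] sum.cong) auto
  also have "\<dots> = (\<Sum>F\<in>N \<union> A. Ext ext \<T> k F (?\<theta> F))"
    by (rule sum.union_disjoint[OF N A(1) disj, symmetric])
  finally have "\<omega> = (\<Sum>F\<in>N \<union> A. Ext ext \<T> k F (?\<theta> F))" .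
  moreover have "m \<le> aff_dim F \<and> ?\<theta> F \<in> bubbles F" if "F \<in> N \<union> A" for F
    using that A(3)[of F] bub[of F] by (auto simp: N_def)
  ultimately show ?case using N A(1,2) N\<U>
    by (intro exI[of _ "N \<union> A"] exI[of _ ?\<theta>]) blast
qed

lemma bubble_uniqueness:
  assumes w: "w \<in> whitney_families vo k \<T> \<U>"
    and A: "finite A" "\<And>F. F \<in> A \<Longrightarrow> F \<in> \<T> \<and> \<eta> F \<in> bubbles F"
    and sum: "w + (\<Sum>F\<in>A. Ext ext \<T> k F (\<eta> F)) = 0"
  shows "w = 0" "\<And>F. F \<in> A \<Longrightarrow> \<eta> F = 0"
proof -
  let ?\<sigma> = "\<Sum>F\<in>A. Ext ext \<T> k F (\<eta> F)"
  show w0: "w = 0"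
  proof (rule whitney_family_unisolvent[OF complex orientation w])
    fix G assume G: "G \<in> \<T>" and dim: "aff_dim G = k"
    have \<sigma>: "?\<sigma> G = (if G \<in> A then \<eta> G else 0)"
    proof (rule sum_Ext_apply[OF G A])
      fix F assume F: "F \<in> A" "F \<in> subsimplices G" "F \<noteq> G"
      have F\<T>: "F \<in> \<T>" using A(2)[OF F(1)] by blast
      \<comment> \<open>A bubble on a proper face of \<open>G\<close> is a \<open>k\<close>-form in
        dimension below \<open>k\<close>, hence zero. What remains on \<open>G\<close> is its own
        bubble, with integral zero.\<close>
      have "aff_dim F < k" using subsimplexD(5)[OF \<T>D(1)[OF G] F(2,3)] dim by simp
      then show "\<eta> F = 0"
        using smooth_forms_eq_0[OF \<T>D(1)[OF F\<T>] bubbles_smooth[OF F\<T>]] A(2)[OF F(1)] by blast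
    qed
    have "w = 0 - ?\<sigma>" using sum by (simp only: eq_diff_eq)
    then have "w G = 0 - ?\<sigma> G" by (simp only: family_diff_apply family_zero_apply)
    also have "\<dots> = form_scale (-1) (?\<sigma> G)" unfolding form_diff_eq by (rule add_0)
    finally have "simplex_integral (vo G) (w G) = - simplex_integral (vo G) (?\<sigma> G)"
      by (simp only: simplex_integral_scale mult_minus1)
    also have "simplex_integral (vo G) (?\<sigma> G) = 0"
      unfolding \<sigma> using A(2)[of G] dim simplex_integral_zero
      by (auto simp: bubble0_forms_def)
    finally show "simplex_integral (vo G) (w G) = 0" by simp
  qed
  have \<sigma>0: "?\<sigma> = 0" using sum unfolding w0 by (simp only: add_0)
  \<comment> \<open>Strong induction on dimension: once the bubbles on proper faces are zero, the
    sum restricted to \<open>F\<close> is \<open>\<eta> F\<close>.\<close>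
  have "\<eta> F = 0" if "F \<in> A" "nat (aff_dim F) = d" for F d
    using that
  proof (induction d arbitrary: F rule: less_induct)
    case (less d)
    have F\<T>: "F \<in> \<T>" using A(2) less.prems by blast
    have "?\<sigma> F = (if F \<in> A then \<eta> F else 0)"
    proof (rule sum_Ext_apply[OF F\<T> A])
      fix F' assume F': "F' \<in> A" "F' \<in> subsimplices F" "F' \<noteq> F"
      have "nat (aff_dim F') < d"
        using subsimplexD(1,5)[OF \<T>D(1)[OF F\<T>] F'(2)] F'(3) nondeg_simplexD(7) less.prems(2) by fastforce
      then show "\<eta> F' = 0" using less.IH F'(1) by blast
    qed
    then show ?case using less.prems(1) \<sigma>0 family_zero_apply by metis
  qed
  then show "\<And>F. F \<in> A \<Longrightarrow> \<eta> F = 0" by blast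
qed

end

text \<open>The index \<open>None\<close> stands for the Whitney summand.
  \<open>contains_Whitney\<close> places that summand in the space being decomposed, which can fail,
  for instance for types of negative order. \<open>Ext_in_direct_sum\<close> expresses that global
  extensions are finitely supported, as membership in the space of families demands; it matters when
  infinitely many simplices meet in \<open>F\<close>.\<close>

theorem theorem5p8:
  fixes \<T> \<U> :: "'a::euclidean_space set set"
    and vo :: "'a set \<Rightarrow> 'a list"
    and P :: "'a set \<Rightarrow> int \<Rightarrow> ptype"
    and ext :: "int \<Rightarrow> 'a set \<Rightarrow> 'a set \<Rightarrow> 'a form \<Rightarrow> 'a form"
    and k :: int
  assumes complex: "simplex_complex \<T>"
    and subcomplex: "simplex_complex \<U>" "\<U> \<subseteq> \<T>"
    and orientation: "\<forall>T\<in>\<T>. vertex_ordering T (vo T)"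
    and types: "\<forall>T\<in>\<T>. admissible (P T)"
    and hierarchy: "\<forall>T\<in>\<T>. \<forall>F\<in>subsimplices T. P F \<le> P T"
    and extension: "extension_operators vo P \<T> ext"
    and Ext_in_direct_sum: "\<forall>F\<in>\<T>. \<forall>\<eta>\<in>bubble0_forms vo (P F k) k F. finite {T. Ext ext \<T> k F \<eta> T \<noteq> 0}"
    and contains_Whitney: "\<forall>T\<in>\<T>. poly_forms vo (PMinus 1) k T \<subseteq> poly_forms vo (P T k) k T"
  shows "is_direct_sum (poly_families vo P k \<T> \<U>)
           (insert None (Some ` (\<T> - \<U>)))
           (case_option (whitney_families vo k \<T> \<U>)
              (\<lambda>F. Ext ext \<T> k F ` bubble0_forms vo (P F k) k F))"
proof (rule is_direct_sum_iff_subgroups)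
  let ?W = "whitney_families vo k \<T> \<U>" and ?X = "poly_families vo P k \<T> \<U>"
  let ?B = "\<lambda>F. bubble0_forms vo (P F k) k F" and ?E = "\<lambda>F. Ext ext \<T> k F"
  let ?S = "case_option ?W (\<lambda>F. ?E F ` ?B F)" and ?I = "insert None (Some ` (\<T> - \<U>))"
  note hyps = complex orientation extension Ext_in_direct_sum
  note TD = complexD[OF complex orientation]
  have "?E F 0 T = 0" for F T
    by (cases "T \<in> \<T> \<and> F \<in> subsimplices T")
      (simp_all only: Ext_def if_True if_False ext_zero[OF hyps] simp_thms)
  then have E0: "?E F 0 = 0" for F
    by (intro HOL.ext) (simp only: family_zero_apply)
  have B0: "0 \<in> ?B F" if "F \<in> \<T>" for F
    using form.subspace_0[OF subspace_bubbles[OF hyps that]] .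
  show zero: "0 \<in> ?S i" if "i \<in> ?I" for i
  proof (cases i)
    case None
    then show ?thesis using poly_families_zero by (simp only: option.case whitney_families_eq)
  next
    case (Some F)
    then show ?thesis using that E0[of F] B0[of F] unfolding Some option.case by (metis DiffD1 image_iff insertE option.distinct(1) option.inject)
  qed
  show "x - y \<in> ?S i" if i: "i \<in> ?I" and xy: "x \<in> ?S i" "y \<in> ?S i" for i x y
  proof (cases i)
    case None
    then show ?thesis
      using xy poly_families_diff by (simp only: option.case whitney_families_eq)
  next
    case (Some F)
    have F: "F \<in> \<T>" using i Some by auto
    obtain \<eta> \<theta> where "\<eta> \<in> ?B F" "\<theta> \<in> ?B F" "x = ?E F \<eta>" "y = ?E F \<theta>"
      using xy unfolding Some option.case by blast
    then show ?thesis
      using Ext_diff[OF hyps F] form.subspace_diff[OF subspace_bubbles[OF hyps F]]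
      unfolding Some option.case by (metis image_eqI)
  qed
  have WX: "?W \<subseteq> ?X"
    using contains_Whitney unfolding whitney_families_def poly_families_def by blast
  have SX: "?S i \<subseteq> ?X" if "i \<in> ?I" for i
    using that WX Ext_mem_poly_families[OF hyps subcomplex(1)] by (cases i) auto
  show "sum f J \<in> ?X" if "J \<subseteq> ?I" "\<And>i. i \<in> J \<Longrightarrow> f i \<in> ?S i" for J f
    using that SX by (intro poly_families_sum) blast
  show "\<exists>J f. finite J \<and> J \<subseteq> ?I \<and> (\<forall>i\<in>J. f i \<in> ?S i) \<and> \<omega> = sum f J" if \<omega>: "\<omega> \<in> ?X" for \<omega>
  proof -
    have smooth: "\<omega> \<in> smooth_families k \<T> \<U>" using \<omega> by (simp add: poly_families_def)
    obtain w where w: "w \<in> ?W"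
      "\<And>G. G \<in> \<T> \<Longrightarrow> aff_dim G = k \<Longrightarrow> simplex_integral (vo G) (w G) = simplex_integral (vo G) (\<omega> G)"
      using whitney_interpolation[OF complex orientation subcomplex(1) smooth] by blast
    have diff: "\<omega> - w \<in> ?X" using poly_families_diff[OF \<omega>] w(1) WX by blast
    have sm: "\<theta> G \<in> smooth_forms k G" if "\<theta> \<in> ?X" "G \<in> \<T>" for \<theta> G
      using that by (simp add: poly_families_def smooth_families_def)
    have "\<exists>A \<eta>. finite A \<and> A \<subseteq> \<T> - \<U> \<and> (\<forall>F\<in>A. k \<le> aff_dim F \<and> \<eta> F \<in> ?B F) \<and>
        \<omega> - w = (\<Sum>F\<in>A. ?E F (\<eta> F))"
    proof (rule bubble_decomposition[OF hyps subcomplex(1) order_refl diff])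
      show "simplex_integral (vo G) ((\<omega> - w) G) = 0" if G: "G \<in> \<T>" "aff_dim G = k" for G
        unfolding family_diff_apply
        using simplex_integral_diff[OF TD(1)[OF G(1)] TD(2)[OF G(1)] sm[OF \<omega> G(1)] sm[of w G]] w(1) w(2)[OF G] WX G(1)
        by (simp add: subset_iff)
      show "(\<omega> - w) G = 0" if G: "G \<in> \<T>" "aff_dim G < k" for G
        using smooth_forms_eq_0[OF TD(1)[OF G(1)] sm[OF diff G(1)]] G(2) by blast
    qed
    then obtain A \<eta> where A: "finite A" "A \<subseteq> \<T> - \<U>" "\<And>F. F \<in> A \<Longrightarrow> \<eta> F \<in> ?B F"
      "\<omega> - w = (\<Sum>F\<in>A. ?E F (\<eta> F))" by blast
    let ?f = "case_option w (\<lambda>F. ?E F (\<eta> F))" and ?J = "insert None (Some ` A)"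
    have "sum ?f ?J = w + (\<Sum>F\<in>A. ?E F (\<eta> F))"
      using A(1) by (subst sum.insert) (auto simp only: sum.reindex inj_Some finite_imageI option.case o_def)
    also have "\<dots> = \<omega>" unfolding A(4)[symmetric] by (simp only: add_diff_eq add_diff_cancel_left')
    finally have "\<omega> = sum ?f ?J" ..
    moreover have "\<forall>i\<in>?J. ?f i \<in> ?S i" using w(1) A(3) by auto
    moreover have "finite ?J" "?J \<subseteq> ?I" using A(1,2) by auto
    ultimately show ?thesis by blast
  qed
  show "f i = 0" if J: "finite J" "J \<subseteq> ?I" "\<And>i. i \<in> J \<Longrightarrow> f i \<in> ?S i" "sum f J = 0" and i: "i \<in> J"
    for J f i
  proof -
    define A where "A = {F. Some F \<in> J}"
    define w where "w = (if None \<in> J then f None else 0)"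
    have A: "finite A" "A \<subseteq> \<T> - \<U>"
      using finite_vimageI[OF J(1) inj_Some] J(2) by (auto simp: A_def vimage_def)
    have "\<forall>F\<in>A. \<exists>\<eta>. \<eta> \<in> ?B F \<and> f (Some F) = ?E F \<eta>" using J(3) by (force simp: A_def)
    then obtain \<eta> where \<eta>: "\<And>F. F \<in> A \<Longrightarrow> \<eta> F \<in> ?B F \<and> f (Some F) = ?E F (\<eta> F)" by metis
    have w: "w \<in> ?W"
      using J(3)[of None] zero[of None] unfolding w_def by auto
    have JA: "J = (if None \<in> J then insert None (Some ` A) else Some ` A)"
    proof (rule Set.set_eqI)
      fix j
      show "j \<in> J \<longleftrightarrow> j \<in> (if None \<in> J then insert None (Some ` A) else Some ` A)"
        by (cases j) (auto simp: A_def)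
    qed
    have "(\<Sum>F\<in>A. ?E F (\<eta> F)) = sum f (Some ` A)"
      using \<eta> by (simp only: sum.reindex inj_Some o_def) (rule sum.cong, auto)
    then have "w + (\<Sum>F\<in>A. ?E F (\<eta> F)) = sum f J"
      using A(1) by (subst JA) (auto simp: w_def)
    then have sum0: "w + (\<Sum>F\<in>A. ?E F (\<eta> F)) = 0" using J(4) by simp
    have A': "F \<in> \<T> \<and> \<eta> F \<in> ?B F" if "F \<in> A" for F using that A(2) \<eta> by blast
    note uniq = bubble_uniqueness[OF hyps w A(1) A' sum0]
    show "f i = 0"
    proof (cases i)
      case None
      then show ?thesis using uniq(1) i unfolding w_def by auto
    next
      case (Some F)
      then have "F \<in> A" using i by (simp add: A_def)
      then show ?thesis using \<eta> uniq(2) E0 unfolding Some by metis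
    qed
  qed
qed

end
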